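(* Let $p$ be an odd prime and $g\ge 1$. Let $G$ be a finite abelian $p$-group of $p$-class $c$ and generator rank $g$. Then $$\mathrm{Meas}_c^{\mathrm{ab}}(G)=\frac{1}{|\mathrm{Aut}(G)|\,|G|}\,p^{g(g+1)}\prod_{k=1}^{g}(1-p^{-k})\prod_{k=g+2-u}^{g+1}(1-p^{-k}),$$ where $u$ is the number of cyclic groups of order strictly less than $p^c$ in the direct product decomposition of $G$ into cyclic groups. Moreover, for every $c'>c$, $$\mathrm{Meas}_{c'}^{\mathrm{ab}}(G)=\frac{1}{|\mathrm{Aut}(G)|\,|G|}\,p^{g(g+1)}\prod_{k=1}^{g}(1-p^{-k})\prod_{k=2}^{g+1}(1-p^{-k}).$$
   Context: Let $F$ be the free pro-$p$ group on $g$ generators and $F^{\mathrm{ab}}$ its abelianization. For a pro-$p$ group $H$, the lower $p$-central series is $P_0(H)=H$, $P_{n+1}(H)=[H,P_n(H)]P_n(H)^p$ (closed subgroups); $H$ has $p$-class $c$ if $P_c(H)=1$ but $P_n(H)\neq 1$ for $n<c$. Put $F_{c'}^{\mathrm{ab}}=F^{\mathrm{ab}}/P_{c'}(F^{\mathrm{ab}})$, and let $\Phi(\cdot)$ denote the Frattini subgroup. For a finite abelian $p$-group $G$ of $p$-class $c$ and generator rank $g$ and $c'\ge c$, a tuple $v=(t_1,\dots,t_{g+1})\in\Phi(F_{c'}^{\mathrm{ab}})^{g+1}$ presents $G$ if $F_{c'}^{\mathrm{ab}}/\langle t_1,\dots,t_{g+1}\rangle\cong G$; let $S_{c'}^{\mathrm{ab}}(G)$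 be the set of such tuples. The abelian$+1$ $c'$-measure is $\mathrm{Meas}_{c'}^{\mathrm{ab}}(G)=|S_{c'}^{\mathrm{ab}}(G)|/|\Phi(F_{c'}^{\mathrm{ab}})|^{g+1}$. *)

theory Defs
  imports "HOL-Algebra.Algebra"
begin

primrec lower_p_central :: "('a, 'b) monoid_scheme \<Rightarrow> nat \<Rightarrow> nat \<Rightarrow> 'a set" where
  "lower_p_central H p 0 = carrier H"
| "lower_p_central H p (Suc n) =
     generate H ({x \<otimes>\<^bsub>H\<^esub> y \<otimes>\<^bsub>H\<^esub> inv\<^bsub>H\<^esub> x \<otimes>\<^bsub>H\<^esub> inv\<^bsub>H\<^esub> y | x y.
                     x \<in> carrier H \<and> y \<in> lower_p_central H p n}
               \<union> {y [^]\<^bsub>H\<^esub> p | y. y \<in> lower_p_central H p n})"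

definition has_p_class :: "('a, 'b) monoid_scheme \<Rightarrow> nat \<Rightarrow> nat \<Rightarrow> bool" where
  "has_p_class H p c \<longleftrightarrow> lower_p_central H p c = {\<one>\<^bsub>H\<^esub>}
      \<and> (\<forall>n<c. lower_p_central H p n \<noteq> {\<one>\<^bsub>H\<^esub>})"

definition generator_rank :: "('a, 'b) monoid_scheme \<Rightarrow> nat" where
  "generator_rank H = (LEAST n. \<exists>S. finite S \<and> card S = n \<and> S \<subseteq> carrier H \<and> generate H S = carrier H)"

definition maximal_subgroup :: "'a set \<Rightarrow> ('a, 'b) monoid_scheme \<Rightarrow> bool" where
  "maximal_subgroup M H \<longleftrightarrow> subgroup M H \<and> M \<noteq> carrier H
     \<and> (\<forall>K. subgroup K H \<and> M \<subseteq> K \<longrightarrow> K = M \<or> K = carrier H)"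

text \<open>Frattini subgroup: intersection of all maximal subgroups (the whole group if there are none).\<close>
definition frattini :: "('a, 'b) monoid_scheme \<Rightarrow> 'a set" where
  "frattini H = carrier H \<inter> \<Inter> {M. maximal_subgroup M H}"

definition card_Aut :: "('a, 'b) monoid_scheme \<Rightarrow> nat" where
  "card_Aut H = card ((\<lambda>f. restrict f (carrier H)) ` iso H H)"

definition Fab_trunc :: "nat \<Rightarrow> nat \<Rightarrow> nat \<Rightarrow> (nat \<Rightarrow>\<^sub>0 int) set monoid" where
  "Fab_trunc p g c' = free_Abelian_group {..<g} Mod lower_p_central (free_Abelian_group {..<g}) p c'"

definition presenting_tuples ::
  "nat \<Rightarrow> nat \<Rightarrow> nat \<Rightarrow> ('a, 'b) monoid_scheme \<Rightarrow> (nat \<Rightarrow>\<^sub>0 int) set list set" where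
  "presenting_tuples p g c' G = {v. length v = g + 1 \<and> set v \<subseteq> frattini (Fab_trunc p g c')
       \<and> (Fab_trunc p g c' Mod generate (Fab_trunc p g c') (set v)) \<cong> G}"

definition Meas_ab :: "nat \<Rightarrow> nat \<Rightarrow> nat \<Rightarrow> ('a, 'b) monoid_scheme \<Rightarrow> real" where
  "Meas_ab p g c' G = real (card (presenting_tuples p g c' G))
       / real (card (frattini (Fab_trunc p g c'))) ^ (g + 1)"

end

theory Submission
  imports Defs
begin

text \<open>
  Let \<open>A = (\<int>/p\<^sup>c)\<^sup>g\<close>, here for any truncation level \<open>c\<close> at which \<open>G\<close> is killed. A tuple presents \<open>G\<close>
  iff it generates a subgroup \<open>N\<close> with \<open>A/N \<cong> G\<close>; as \<open>G\<close> has rank \<open>g\<close>, every such \<open>N\<close> lies in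
  \<open>\<Phi>(A) = pA\<close>. Surjections \<open>A \<rightarrow> G\<close> are the generating \<open>g\<close>-tuples of \<open>G\<close>, and those with a given
  kernel form a torsor under \<open>Aut(G)\<close>, which gives the number of subgroups \<open>N\<close>. Each \<open>N\<close> has order
  \<open>|A|/|G|\<close>, and its rank \<open>r\<close> is read off its \<open>p\<close>-torsion: since \<open>A[p] = p\<^bsup>c-1\<^esup>A\<close> is mapped onto
  \<open>p\<^bsup>c-1\<^esup>G\<close>, one has \<open>p\<^sup>r = p\<^sup>g / |p\<^bsup>c-1\<^esup>G|\<close>. Both counts thus reduce to the number of
  generating \<open>n\<close>-tuples of a finite abelian \<open>p\<close>-group \<open>H\<close> of rank \<open>r\<close>, which is
  \<open>|H|\<^sup>n \<Prod>\<^sub>i\<^sub><\<^sub>r (1 - p\<^bsup>i-n\<^esup>)\<close>.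
\<close>

section \<open>Power subgroups and the Frattini subgroup\<close>

definition power_image :: "('a, 'b) monoid_scheme \<Rightarrow> nat \<Rightarrow> 'a set" where
  "power_image G n = (\<lambda>x. x [^]\<^bsub>G\<^esub> n) ` carrier G"

section \<open>Fibres of a homomorphism\<close>

text \<open>Each fibre over a point of the image is a translate of the kernel, and the preimage of
  \<open>S\<close> is the disjoint union of the fibres over \<open>S\<close>.\<close>

lemma (in group_hom) card_preimage:
  assumes "finite (carrier G)" and "S \<subseteq> h ` carrier G"
  shows "card {x \<in> carrier G. h x \<in> S} = card S * card (kernel G H h)"
proof -
  have fib: "card {x \<in> carrier G. h x = s} = card (kernel G H h)" if s: "s \<in> S" for s
  proof -
    obtain a where a: "a \<in> carrier G" "h a = s" using s assms(2) by auto
    have "bij_betw (\<lambda>x. a \<otimes> x) (kernel G H h) {x \<in> carrier G. h x = s}"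
    proof (rule bij_betw_byWitness[where f' = "\<lambda>x. inv a \<otimes> x"])
      show "\<forall>x\<in>kernel G H h. inv a \<otimes> (a \<otimes> x) = x"
        using a by (auto simp: kernel_def G.m_assoc[symmetric])
      show "\<forall>x\<in>{x \<in> carrier G. h x = s}. a \<otimes> (inv a \<otimes> x) = x"
        using a by (auto simp: G.m_assoc[symmetric])
      show "(\<otimes>) a ` kernel G H h \<subseteq> {x \<in> carrier G. h x = s}"
        using a by (auto simp: kernel_def)
      show "(\<otimes>) (inv a) ` {x \<in> carrier G. h x = s} \<subseteq> kernel G H h"
        using a by (auto simp: kernel_def)
    qed
    then show ?thesis by (simp add: bij_betw_same_card)
  qed
  have "finite S" using assms finite_surj by blast
  have "{x \<in> carrier G. h x \<in> S} = (\<Union>s\<in>S. {x \<in> carrier G. h x = s})" by auto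
  also have "card \<dots> = (\<Sum>s\<in>S. card {x \<in> carrier G. h x = s})"
    by (rule card_UN_disjoint) (use assms \<open>finite S\<close> in auto)
  finally show ?thesis using fib by simp
qed

lemma (in group_hom) card_image_kernel:
  assumes "finite (carrier G)"
  shows "card (carrier G) = card (h ` carrier G) * card (kernel G H h)"
proof -
  have "{x \<in> carrier G. h x \<in> h ` carrier G} = carrier G" by auto
  then show ?thesis using card_preimage[OF assms order_refl] by simp
qed

context comm_group
begin

section \<open>Power maps and the lower p-central series\<close>

lemma pow_hom: "(\<lambda>x. x [^] (n::nat)) \<in> hom G G"
  by (rule homI) (auto simp: nat_pow_distrib)

lemma pow_group_hom: "group_hom G G (\<lambda>x. x [^] (n::nat))"
  using pow_hom by (simp add: group_hom_def group_hom_axioms_def)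

lemma subgroup_power_image: "subgroup (power_image G n) G"
  unfolding power_image_def
  using group_hom.img_is_subgroup[OF pow_group_hom] by simp

lemma power_image_subset: "power_image G n \<subseteq> carrier G"
  unfolding power_image_def by auto

lemma pow_in_power_image: "x \<in> carrier G \<Longrightarrow> x [^] n \<in> power_image G n"
  unfolding power_image_def by auto

lemma generate_subgroup: "subgroup H G \<Longrightarrow> generate G H = H"
  by (meson generate.incl generate_subgroup_incl order_refl subsetI subset_antisym)

text \<open>Commutators are trivial here, so each step of the series only takes p-th powers; these
  already form a subgroup, and \<open>generate\<close> adds nothing.\<close>

lemma lower_p_central_eq: "lower_p_central G p n = power_image G (p ^ n)"
proof (induction n)
  case 0
  then show ?case by (auto simp: power_image_def)
next
  case (Suc n)
  have 1: "{x \<otimes> y \<otimes> inv x \<otimes> inv y | x y. x \<in> carrier G \<and> y \<in> power_image G (p ^ n)} \<subseteq> {\<one>}"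
  proof (clarify, simp)
    fix x y assume "x \<in> carrier G" and "y \<in> power_image G (p ^ n)"
    then have "y \<in> carrier G" using power_image_subset by auto
    with \<open>x \<in> carrier G\<close> show "x \<otimes> y \<otimes> inv x \<otimes> inv y = \<one>"
      by (metis inv_solve_right' m_closed m_comm r_inv inv_closed inv_solve_right one_closed l_one m_assoc)
  qed
  have 2: "{y [^] p | y. y \<in> power_image G (p ^ n)} = power_image G (p ^ Suc n)"
  proof -
    have *: "(x [^] (p ^ n)) [^] p = x [^] (p ^ Suc n)" if "x \<in> carrier G" for x
      unfolding nat_pow_pow[OF that] power_Suc by (simp only: mult.commute)
    have "{y [^] p | y. y \<in> power_image G (p ^ n)} = (\<lambda>x. (x [^] (p ^ n)) [^] p) ` carrier G"
      unfolding power_image_def by fast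
    also have "\<dots> = power_image G (p ^ Suc n)"
      unfolding power_image_def by (rule image_cong[OF refl *])
    finally show ?thesis .
  qed
  have "{\<one>} \<subseteq> power_image G (p ^ Suc n)"
    using subgroup.one_closed[OF subgroup_power_image] by simp
  then have "{x \<otimes> y \<otimes> inv x \<otimes> inv y | x y. x \<in> carrier G \<and> y \<in> power_image G (p ^ n)}
    \<union> {y [^] p | y. y \<in> power_image G (p ^ n)} = power_image G (p ^ Suc n)"
    unfolding 2 by (rule Un_absorb1[OF subset_trans[OF 1]])
  then show ?case unfolding lower_p_central.simps Suc by (simp only: generate_subgroup[OF subgroup_power_image])
qed

text \<open>Kernel-image count for the power map. For \<open>n = p\<close> it identifies the index
  of the p-th powers with the order of the p-torsion, so a rank given by torsion serves as the rank
  of G/pG.\<close>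

lemma card_power_image_torsion:
  assumes "finite (carrier G)"
  shows "card (carrier G) = card (power_image G n) * card {x \<in> carrier G. x [^] n = \<one>}"
  using group_hom.card_image_kernel[OF pow_group_hom[of n] assms]
  unfolding power_image_def kernel_def by simp

section \<open>p-th powers as non-generators\<close>

lemma set_mult_memI: "h \<in> H \<Longrightarrow> k \<in> K \<Longrightarrow> h \<otimes> k \<in> H <#> K"
  unfolding set_mult_def by auto

lemma mem_set_mult_power_imageE:
  assumes "x \<in> H <#> power_image G n"
  obtains h y where "h \<in> H" "y \<in> carrier G" "x = h \<otimes> y [^] n"
  using assms unfolding set_mult_def power_image_def by auto

text \<open>A Nakayama argument: substituting G = H G^p into its own second factor gives G = H
  G^(p^j) for every j by induction, and at j = k the power subgroup is trivial.\<close>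

lemma eq_carrier_if_generates_mod_power_image:
  assumes H: "subgroup H G" and gen: "H <#> power_image G p = carrier G"
    and exp: "\<And>x. x \<in> carrier G \<Longrightarrow> x [^] (p ^ k :: nat) = \<one>"
  shows "H = carrier G"
proof -
  have Hc: "H \<subseteq> carrier G" using H by (rule subgroup.subset)
  have "carrier G \<subseteq> H <#> power_image G (p ^ j)" for j
  proof (induction j)
    case 0
    show ?case
    proof
      fix x assume x: "x \<in> carrier G"
      then have "\<one> \<otimes> x [^] (p ^ 0) \<in> H <#> power_image G (p ^ 0)"
        by (intro set_mult_memI subgroup.one_closed[OF H] pow_in_power_image)
      then show "x \<in> H <#> power_image G (p ^ 0)" using x by simp
    qed
  next
    case (Suc j)
    show ?case
    proof
      fix x assume xc: "x \<in> carrier G"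
      obtain h y where x: "h \<in> H" "y \<in> carrier G" "x = h \<otimes> y [^] (p ^ j)"
        using subsetD[OF Suc xc] by (rule mem_set_mult_power_imageE)
      obtain h' z where y: "h' \<in> H" "z \<in> carrier G" "y = h' \<otimes> z [^] p"
        using x(2)[folded gen] by (rule mem_set_mult_power_imageE)
      have "h' [^] (p ^ j) \<in> H" using y(1) H
        by (metis int_pow_int subgroup_int_pow_closed)
      then have "h \<otimes> h' [^] (p ^ j) \<in> H" using x(1) H by (simp add: subgroup.m_closed)
      moreover have "x = (h \<otimes> h' [^] (p ^ j)) \<otimes> z [^] (p ^ Suc j)"
        using x y Hc by (auto simp: nat_pow_distrib nat_pow_pow m_assoc subsetD)
      ultimately show "x \<in> H <#> power_image G (p ^ Suc j)"
        using set_mult_memI pow_in_power_image[OF y(2)] by simp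
    qed
  qed
  moreover have "power_image G (p ^ k) \<subseteq> {\<one>}"
    using exp unfolding power_image_def by auto
  ultimately have "carrier G \<subseteq> H <#> {\<one>}"
    by (rule subset_trans[OF _ mono_set_mult[OF order_refl]])
  also have "H <#> {\<one>} = H"
    using coset_mult_one[OF Hc] by (simp add: r_coset_eq_set_mult)
  finally show ?thesis using Hc by simp
qed

lemma subset_set_mult:
  assumes "subgroup H G" "subgroup K G"
  shows "H \<subseteq> H <#> K" "K \<subseteq> H <#> K"
proof -
  have "\<one> \<in> H" "\<one> \<in> K" "H \<subseteq> carrier G" "K \<subseteq> carrier G"
    using assms by (auto simp: subgroup.one_closed subgroup.subset dest: subgroup.subset)
  then show "H \<subseteq> H <#> K" "K \<subseteq> H <#> K"
    unfolding set_mult_def by (force, force)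
qed

lemma generate_Un:
  assumes "subgroup H G" "subgroup K G"
  shows "generate G (H \<union> K) = H <#> K"
proof
  show "generate G (H \<union> K) \<subseteq> H <#> K"
    using generate_subgroup_incl mult_subgroups[OF assms] subset_set_mult[OF assms] by simp
  show "H <#> K \<subseteq> generate G (H \<union> K)"
    unfolding set_mult_def by (auto intro: generate.eng generate.incl)
qed

lemma generate_insert:
  assumes K: "subgroup K G" and x: "x \<in> carrier G"
  shows "generate G (insert x K) = generate G {x} <#> K"
proof -
  have g: "subgroup (generate G {x}) G" using x by (simp add: generate_is_subgroup)
  have Kc: "K \<subseteq> carrier G" using K by (rule subgroup.subset)
  have "generate G (insert x K) \<subseteq> generate G (generate G {x} \<union> K)"
    by (rule mono_generate) (auto intro: generate.incl)
  moreover have "generate G (generate G {x} \<union> K) \<subseteq> generate G (insert x K)"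
  proof (rule generate_subgroup_incl)
    show "subgroup (generate G (insert x K)) G" using x Kc by (simp add: generate_is_subgroup)
    show "generate G {x} \<union> K \<subseteq> generate G (insert x K)"
      using mono_generate[of "{x}" "insert x K"] by (auto intro: generate.incl)
  qed
  ultimately show ?thesis using generate_Un[OF g K] by simp
qed

text \<open>By Bezout, x is itself a product of powers of the two given elements of
  \<open>H\<close>.\<close>

lemma mem_of_coprime_pow:
  assumes H: "subgroup H G" and x: "x \<in> carrier G" and "x [^] (m::nat) \<in> H"
    and "x [^] (k::int) \<in> H" and "coprime (int m) k"
  shows "x \<in> H"
proof -
  obtain a b where ab: "a * int m + b * k = 1"
    using assms(5) bezout_int[of "int m" k] by auto
  have 1: "(x [^] int m) [^] a \<in> H" "(x [^] k) [^] b \<in> H"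
    using assms subgroup_int_pow_closed by (auto simp: int_pow_int)
  have "x = x [^] (int m * a + k * b)" using ab x by (simp add: mult.commute)
  also have "\<dots> = (x [^] int m) [^] a \<otimes> (x [^] k) [^] b"
    using x by (simp add: int_pow_mult int_pow_pow)
  finally have "x = (x [^] int m) [^] a \<otimes> (x [^] k) [^] b" .
  then show ?thesis using subgroup.m_closed[OF H 1] by argo
qed

text \<open>A subgroup maximal among those that contain all \<open>p\<close>-th powers and avoid \<open>x\<close> is already a
  maximal subgroup.\<close>
lemma exists_maximal_subgroup_avoiding:
  assumes fin: "finite (carrier G)" and p: "Factorial_Ring.prime p"
    and x: "x \<in> carrier G" "x \<notin> power_image G p"
  shows "\<exists>M. maximal_subgroup M G \<and> x \<notin> M"
proof -
  let ?C = "{H. subgroup H G \<and> power_image G p \<subseteq> H \<and> x \<notin> H}"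
  have "?C \<subseteq> Pow (carrier G)" using subgroup.subset by auto
  then have "finite ?C" using fin by (meson finite_Pow_iff finite_subset)
  moreover have "power_image G p \<in> ?C" using x subgroup_power_image by simp
  ultimately obtain M where M: "M \<in> ?C" and max: "\<And>H. H \<in> ?C \<Longrightarrow> M \<subseteq> H \<Longrightarrow> H = M"
    using finite_has_maximal[of ?C] by (metis (no_types, lifting) empty_iff)
  have M': "subgroup M G" "power_image G p \<subseteq> M" "x \<notin> M" using M by auto
  have "K = carrier G" if K: "subgroup K G" "M \<subseteq> K" "K \<noteq> M" for K
  proof -
    have xK: "x \<in> K" using max[of K] K M' by auto
    have "y \<in> K" if y: "y \<in> carrier G" for y
    proof (cases "y \<in> M")
      case False
      \<comment> \<open>Maximality of \<open>M\<close> forces x into the subgroup generated by M and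
        y, so x = y^k m. If p divided k, then y^k and hence x would lie in M; so k is prime to p,
        and y is recovered in K from y^p and y^k.\<close>
      let ?L = "generate G (insert y M)"
      have sub: "insert y M \<subseteq> carrier G" using y M' subgroup.subset by auto
      have "subgroup ?L G" "M \<subseteq> ?L" "y \<in> ?L"
        using sub by (auto simp: generate_is_subgroup intro: generate.incl)
      then have "x \<in> ?L" using max[of ?L] M' False by auto
      then obtain k m where km: "x = y [^] (k::int) \<otimes> m" "m \<in> M"
        using generate_insert[OF M'(1) y] generate_pow[OF y] unfolding set_mult_def by auto
      have yp: "y [^] p \<in> M" using pow_in_power_image[OF y] M' by auto
      have mc: "m \<in> carrier G" using km M' subgroup.subset by blast
      have "\<not> int p dvd k"
      proof
        assume "int p dvd k"
        then obtain j where "k = int p * j" by auto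
        then have "y [^] k = (y [^] p) [^] j" using y by (simp add: int_pow_pow int_pow_int[symmetric])
        then have "y [^] k \<in> M" using yp M' subgroup_int_pow_closed by simp
        then show False using km M' by (simp add: subgroup.m_closed)
      qed
      then have cop: "coprime (int p) k" using p by (simp add: prime_imp_coprime)
      have "y [^] k = x \<otimes> inv m" using km mc y by (simp add: m_assoc)
      then have "y [^] k \<in> K" using xK km(2) K
        by (simp add: subgroup.m_closed subgroup.m_inv_closed subset_iff)
      then show ?thesis using mem_of_coprime_pow[OF K(1) y _ _ cop] yp K by auto
    qed (use K in auto)
    then show ?thesis using K subgroup.subset by blast
  qed
  then have "maximal_subgroup M G" unfolding maximal_subgroup_def using M' x by blast
  then show ?thesis using M' by blast
qed

text \<open>An element that is not a p-th power is avoided by some maximal subgroup. Conversely, a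
  maximal M not containing the p-th powers would generate G together with them, which the Nakayama
  argument excludes.\<close>

lemma frattini_eq:
  assumes fin: "finite (carrier G)" and p: "Factorial_Ring.prime p"
    and exp: "\<And>x. x \<in> carrier G \<Longrightarrow> x [^] (p ^ k :: nat) = \<one>"
  shows "frattini G = power_image G p"
proof
  show "frattini G \<subseteq> power_image G p"
    using exists_maximal_subgroup_avoiding[OF fin p] unfolding frattini_def by blast
  have "power_image G p \<subseteq> M" if M: "maximal_subgroup M G" for M
  proof -
    have sM: "subgroup M G" using M unfolding maximal_subgroup_def by simp
    let ?K = "M <#> power_image G p"
    have "subgroup ?K G" "M \<subseteq> ?K" and sub: "power_image G p \<subseteq> ?K"
      using mult_subgroups subset_set_mult sM subgroup_power_image by auto
    then have "?K = M \<or> ?K = carrier G" using M unfolding maximal_subgroup_def by blast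
    moreover have "?K \<noteq> carrier G"
      using eq_carrier_if_generates_mod_power_image[OF sM _ exp] M
      unfolding maximal_subgroup_def by blast
    ultimately show ?thesis using sub by simp
  qed
  then show "power_image G p \<subseteq> frattini G"
    unfolding frattini_def using power_image_subset by blast
qed

end

section \<open>Counting generating tuples\<close>

text \<open>The fraction of \<open>n\<close>-tuples that generate a finite abelian \<open>p\<close>-group of rank \<open>r\<close>.
  It vanishes for \<open>n < r\<close> because of the factor with \<open>i = n\<close>.\<close>
definition rank_factor :: "nat \<Rightarrow> nat \<Rightarrow> nat \<Rightarrow> real" where
  "rank_factor p r n = (\<Prod>i<r. 1 - real p ^ i / real p ^ n)"

lemma rank_factor_0_right: "rank_factor p r 0 = (if r = 0 then 1 else 0)"
  unfolding rank_factor_def by (auto simp: prod_zero_iff intro!: bexI[of _ 0])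

text \<open>This is the first-entry recursion in numbers: in a quotient of rank r+1 a random entry
  is trivial with probability 1/p^(r+1), and otherwise the rank drops to r. For the proof, both
  factors of rank r+1 are multiples of \<open>rank_factor p r n\<close>: one splits off its first
  term, the other its last.\<close>

lemma rank_factor_rec:
  assumes "p > 0"
  shows "rank_factor p (Suc r) (Suc n) =
    rank_factor p (Suc r) n / real p ^ Suc r + (1 - 1 / real p ^ Suc r) * rank_factor p r n"
proof -
  have "rank_factor p (Suc r) (Suc n) = (1 - 1 / real p ^ Suc n) * rank_factor p r n"
    unfolding rank_factor_def prod.lessThan_Suc_shift using assms by simp
  moreover have "rank_factor p (Suc r) n = rank_factor p r n * (1 - real p ^ r / real p ^ n)"
    unfolding rank_factor_def by simp
  moreover have "1 - 1 / real p ^ Suc n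
      = (1 - real p ^ r / real p ^ n) / real p ^ Suc r + (1 - 1 / real p ^ Suc r)"
    using assms by (simp add: field_simps)
  moreover have "(a / q + b) * f = f * a / q + b * f" for f a q b :: real
    by (simp add: algebra_simps)
  ultimately show ?thesis by (simp only:)
qed

lemma rank_factor_pos_iff:
  assumes "p > 1"
  shows "rank_factor p r n \<noteq> 0 \<longleftrightarrow> r \<le> n"
proof -
  have "rank_factor p r n = 0 \<longleftrightarrow> (\<exists>i<r. i = n)"
    unfolding rank_factor_def using assms by (auto simp: prod_zero_iff power_inject_exp)
  then show ?thesis by auto
qed

lemma rank_factor_eq_prod:
  assumes "p > 0" and "r \<le> n"
  shows "rank_factor p r n = (\<Prod>k=Suc n - r..n. 1 - 1 / real p ^ k)"
  unfolding rank_factor_def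
proof (rule prod.reindex_bij_witness[of _ "\<lambda>k. n - k" "\<lambda>i. n - i"])
  fix i assume "i \<in> {..<r}"
  then have "i \<le> n" using assms by simp
  then show "1 - 1 / real p ^ (n - i) = 1 - real p ^ i / real p ^ n"
    using assms by (simp add: power_diff)
qed (use assms in auto)

section \<open>Tuples generating a group, outright or modulo a subgroup\<close>

definition generating_tuples :: "('a, 'b) monoid_scheme \<Rightarrow> nat \<Rightarrow> 'a list set" where
  "generating_tuples G n = {xs. length xs = n \<and> set xs \<subseteq> carrier G \<and> generate G (set xs) = carrier G}"

text \<open>The subgroup \<open>K\<close> absorbs the entries already read, which makes induction on
  the length of the tuple possible.\<close>

definition tuples_generating_mod :: "('a, 'b) monoid_scheme \<Rightarrow> 'a set \<Rightarrow> nat \<Rightarrow> 'a list set" where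
  "tuples_generating_mod G K n =
     {xs. length xs = n \<and> set xs \<subseteq> carrier G \<and> generate G (set xs \<union> K) = carrier G}"

lemma finite_tuples_generating_mod:
  "finite (carrier G) \<Longrightarrow> finite (tuples_generating_mod G K n)"
  unfolding tuples_generating_mod_def
  by (rule finite_subset[OF _ finite_lists_length_eq[of "carrier G" n]]) auto

context comm_group
begin

lemma generate_Un_generate:
  assumes "A \<subseteq> carrier G" "B \<subseteq> carrier G"
  shows "generate G (A \<union> generate G B) = generate G (A \<union> B)"
proof
  have "subgroup (generate G (A \<union> B)) G" using assms by (simp add: generate_is_subgroup)
  moreover have "A \<union> generate G B \<subseteq> generate G (A \<union> B)"
    using mono_generate[of B "A \<union> B"] by (auto intro: generate.incl)
  ultimately show "generate G (A \<union> generate G B) \<subseteq> generate G (A \<union> B)"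
    using generate_subgroup_incl by simp
  show "generate G (A \<union> B) \<subseteq> generate G (A \<union> generate G B)"
    by (rule mono_generate) (auto intro: generate.incl)
qed

text \<open>The class of x has order p modulo K, so every element of the larger subgroup is x^i k
  for exactly one i < p and one k in K.\<close>

lemma card_generate_insert:
  assumes p: "Factorial_Ring.prime p" and K: "subgroup K G"
    and x: "x \<in> carrier G" "x \<notin> K" "x [^] (p::nat) \<in> K"
  shows "card (generate G (insert x K)) = p * card K"
proof -
  have Kc: "k \<in> carrier G" if "k \<in> K" for k using that K subgroup.subset by blast
  let ?f = "\<lambda>(i::nat, k). x [^] i \<otimes> k"
  have "inj_on ?f ({..<p} \<times> K)"
  proof (rule inj_onI, clarsimp)
    fix i k j k' assume h: "i < p" "k \<in> K" "j < p" "k' \<in> K" and e: "x [^] i \<otimes> k = x [^] j \<otimes> k'"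
    have "x [^] (int i - int j) = x [^] i \<otimes> inv (x [^] j)"
      using x by (simp add: int_pow_diff int_pow_int)
    also have "\<dots> = k' \<otimes> inv k"
    proof -
      have "x [^] i = x [^] j \<otimes> k' \<otimes> inv k"
        using e h Kc x by (metis inv_solve_right m_closed nat_pow_closed)
      then show ?thesis using h Kc x by (simp add: m_ac)
    qed
    finally have "x [^] (int i - int j) = k' \<otimes> inv k" .
    then have d: "x [^] (int i - int j) \<in> K"
      using h K by (simp add: subgroup.m_closed subgroup.m_inv_closed)
    \<comment> \<open>Otherwise 0 < |i - j| < p, so i - j is prime to p, and x^(i-j) together with
      x^p would put x into K.\<close>
    have ij: "i = j"
    proof (rule ccontr)
      assume "i \<noteq> j"
      have "\<not> int p dvd int i - int j"
      proof
        assume "int p dvd int i - int j"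
        then have "\<bar>int p\<bar> \<le> \<bar>int i - int j\<bar>" using \<open>i \<noteq> j\<close> by (intro dvd_imp_le_int) auto
        then show False using h by linarith
      qed
      then have "coprime (int p) (int i - int j)" using p by (simp add: prime_imp_coprime)
      then show False using mem_of_coprime_pow[OF K x(1) x(3) d] x(2) by simp
    qed
    then show "i = j \<and> k = k'" using e h Kc x by simp
  qed
  moreover have "?f ` ({..<p} \<times> K) = generate G (insert x K)"
  proof
    have "x [^] i \<otimes> k \<in> generate G {x} <#> K" if "k \<in> K" for i :: nat and k
      using that generate_pow[OF x(1)] by (intro set_mult_memI) (auto intro!: exI[of _ "int i"] simp: int_pow_int)
    then show "?f ` ({..<p} \<times> K) \<subseteq> generate G (insert x K)"
      unfolding generate_insert[OF K x(1)] by auto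
    show "generate G (insert x K) \<subseteq> ?f ` ({..<p} \<times> K)"
    proof
      fix y assume "y \<in> generate G (insert x K)"
      then obtain m k where y: "k \<in> K" "y = x [^] (m::int) \<otimes> k"
        unfolding generate_insert[OF K x(1)] generate_pow[OF x(1)] set_mult_def by auto
      \<comment> \<open>Reduce the exponent modulo p; the remaining power of x^p is moved into the
        factor from K.\<close>
      define i where "i = nat (m mod int p)"
      have p0: "p > 0" using p by (simp add: prime_gt_0_nat)
      have i: "i < p" "int i = m mod int p"
        using p0 unfolding i_def by (auto simp: nat_less_iff)
      have "x [^] m = x [^] (int i + int p * (m div int p))" using i by simp
      also have "\<dots> = x [^] i \<otimes> (x [^] p) [^] (m div int p)"
        using x by (simp add: int_pow_mult int_pow_pow[symmetric] int_pow_int)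
      finally have "y = x [^] i \<otimes> ((x [^] p) [^] (m div int p) \<otimes> k)"
        using y x Kc by (simp add: m_assoc)
      moreover have "(x [^] p) [^] (m div int p) \<otimes> k \<in> K"
        using K subgroup_int_pow_closed[OF K x(3)] y(1) by (simp add: subgroup.m_closed)
      ultimately show "y \<in> ?f ` ({..<p} \<times> K)" using i(1) by auto
    qed
  qed
  ultimately have "card (generate G (insert x K)) = card ({..<p} \<times> K)"
    by (metis card_image)
  then show ?thesis by (simp add: card_cartesian_product)
qed

text \<open>Sort the tuples by their first entry x, which is then moved from the tuple into the
  subgroup.\<close>

lemma card_tuples_generating_mod_Suc:
  assumes fin: "finite (carrier G)" and K: "K \<subseteq> carrier G"
  shows "card (tuples_generating_mod G K (Suc n))
    = (\<Sum>x\<in>carrier G. card (tuples_generating_mod G (generate G (insert x K)) n))"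
proof -
  have e: "generate G (set (x # xs) \<union> K) = generate G (set xs \<union> generate G (insert x K))"
    if "x \<in> carrier G" "set xs \<subseteq> carrier G" for x xs
    using generate_Un_generate[of "set xs" "insert x K"] that K by simp
  have "tuples_generating_mod G K (Suc n)
      = (\<Union>x\<in>carrier G. (#) x ` tuples_generating_mod G (generate G (insert x K)) n)" (is "?L = ?R")
  proof
    show "?L \<subseteq> ?R"
    proof
      fix ys assume "ys \<in> ?L"
      then obtain x xs where ys: "ys = x # xs" "length xs = n" "x \<in> carrier G" "set xs \<subseteq> carrier G"
        and gen: "generate G (set (x # xs) \<union> K) = carrier G"
        unfolding tuples_generating_mod_def by (auto simp: length_Suc_conv)
      have "xs \<in> tuples_generating_mod G (generate G (insert x K)) n"
        unfolding tuples_generating_mod_def using ys(2,4) gen[unfolded e[OF ys(3,4)]] by blast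
      then show "ys \<in> ?R" using ys(1,3) by blast
    qed
    show "?R \<subseteq> ?L"
      unfolding tuples_generating_mod_def using e by auto
  qed
  also have "card \<dots> = (\<Sum>x\<in>carrier G. card ((#) x ` tuples_generating_mod G (generate G (insert x K)) n))"
    by (rule card_UN_disjoint) (use fin in \<open>auto simp: finite_tuples_generating_mod\<close>)
  finally show ?thesis by (simp add: card_image)
qed

lemma tuples_generating_mod_0:
  "tuples_generating_mod G K 0 = (if generate G K = carrier G then {[]} else {})"
proof -
  have "length xs = 0 \<and> set xs \<subseteq> carrier G \<and> generate G (set xs \<union> K) = carrier G \<longleftrightarrow> xs = [] \<and> generate G K = carrier G" for xs
    by (cases xs) (simp_all only: list.set Un_empty_left empty_subsetI simp_thms list.distinct list.size nat.distinct One_nat_def add_Suc_right)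
  then have "tuples_generating_mod G K 0 = {xs. xs = [] \<and> generate G K = carrier G}"
    by (simp only: tuples_generating_mod_def)
  then show ?thesis by (cases "generate G K = carrier G") (simp_all only: simp_thms if_True if_False Collect_const singleton_conv)
qed

text \<open>Induction on the tuple: the first entry either lies in \<open>K\<close>, or adjoining it to \<open>K\<close>
  lowers the rank of the quotient from \<open>r\<close> to \<open>r - 1\<close>.\<close>
lemma card_tuples_generating_mod:
  assumes fin: "finite (carrier G)" and p: "Factorial_Ring.prime p"
    and "subgroup K G" and "power_image G p \<subseteq> K" and "card (carrier G) = card K * p ^ r"
  shows "real (card (tuples_generating_mod G K n)) = real (card (carrier G)) ^ n * rank_factor p r n"
  using assms(3-)
proof (induction n arbitrary: K r)
  case 0
  have gK: "generate G K = K" using 0(1) by (simp add: generate_subgroup)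
  have Kc: "K \<subseteq> carrier G" using 0(1) by (simp add: subgroup.subset)
  have K0: "card K > 0"
    using subgroup.finite_imp_card_positive[OF 0(1) fin] .
  \<comment> \<open>The empty tuple works exactly when K is everything, that is, when the index p^r
    is 1.\<close>
  have "K = carrier G \<longleftrightarrow> card K = card (carrier G)"
    using card_subset_eq[OF fin Kc] by (intro iffI) simp_all
  also have "\<dots> \<longleftrightarrow> p ^ r = 1"
    unfolding 0(3) using mult_cancel_left[of "card K" "p ^ r" 1] K0 by linarith
  also have "\<dots> \<longleftrightarrow> r = 0"
    using prime_gt_1_nat[OF p] by simp
  finally have "generate G K = carrier G \<longleftrightarrow> r = 0" unfolding gK .
  moreover have "tuples_generating_mod G K 0 = (if generate G K = carrier G then {[]} else {})"
    by (rule tuples_generating_mod_0)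
  ultimately have "tuples_generating_mod G K 0 = (if r = 0 then {[]} else {})"
    by (simp only:)
  then show ?case by (simp add: rank_factor_0_right)
next
  case (Suc n)
  let ?T = "\<lambda>x. real (card (tuples_generating_mod G (generate G (insert x K)) n))"
  let ?N = "real (card (carrier G))"
  have Kc: "K \<subseteq> carrier G" using Suc.prems(1) by (simp add: subgroup.subset)
  have finK: "finite K" using finite_subset[OF Kc fin] .
  have p0: "p > 0" using p by (simp add: prime_gt_0_nat)
  have in_K: "?T x = ?N ^ n * rank_factor p r n" if "x \<in> K" for x
    using Suc.IH[OF Suc.prems] that by (simp add: insert_absorb generate_subgroup[OF Suc.prems(1)])
  have "real (card (tuples_generating_mod G K (Suc n))) = (\<Sum>x\<in>carrier G. ?T x)"
    using card_tuples_generating_mod_Suc[OF fin Kc] by simp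
  also have "\<dots> = (\<Sum>x\<in>carrier G - K. ?T x) + (\<Sum>x\<in>K. ?T x)"
    by (rule sum.subset_diff[OF Kc fin])
  also have "(\<Sum>x\<in>K. ?T x) = real (card K) * (?N ^ n * rank_factor p r n)"
    using in_K by simp
  finally have main: "real (card (tuples_generating_mod G K (Suc n)))
      = (\<Sum>x\<in>carrier G - K. ?T x) + real (card K) * (?N ^ n * rank_factor p r n)" .
  show ?case
  \<comment> \<open>For r = 0 no element lies outside K, so the rank-lowering case does not
    occur.\<close>
  proof (cases r)
    case 0
    then have "K = carrier G" using Suc.prems(3) card_subset_eq[OF fin Kc] by simp
    then show ?thesis using main 0 by (simp add: rank_factor_def)
  next
    case (Suc r')
    have out_K: "?T x = ?N ^ n * rank_factor p r' n" if "x \<in> carrier G - K" for x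
    proof (rule Suc.IH)
      have x: "x \<in> carrier G" "x \<notin> K" "x [^] p \<in> K"
        using that Suc.prems(2) pow_in_power_image by auto
      show "subgroup (generate G (insert x K)) G" using x Kc by (simp add: generate_is_subgroup)
      show "power_image G p \<subseteq> generate G (insert x K)"
        using Suc.prems(2) by (auto intro: generate.incl)
      show "card (carrier G) = card (generate G (insert x K)) * p ^ r'"
        using card_generate_insert[OF p Suc.prems(1) x] Suc.prems(3) Suc by simp
    qed
    have NK: "?N = real (card K) * real p ^ Suc r'" using Suc.prems(3) Suc by simp
    then have k: "real (card K) = ?N / real p ^ Suc r'" using p0 by simp
    have "(\<Sum>x\<in>carrier G - K. ?T x) = real (card (carrier G - K)) * (?N ^ n * rank_factor p r' n)"
      using out_K by simp
    also have "real (card (carrier G - K)) = ?N - real (card K)"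
      using Kc finK fin by (simp add: card_Diff_subset of_nat_diff card_mono)
    finally have "real (card (tuples_generating_mod G K (Suc n)))
      = (?N - ?N / real p ^ Suc r') * (?N ^ n * rank_factor p r' n)
        + ?N / real p ^ Suc r' * (?N ^ n * rank_factor p r n)"
      by (simp only: main k)
    also have "\<dots> = ?N ^ Suc n * (rank_factor p (Suc r') n / real p ^ Suc r'
        + (1 - 1 / real p ^ Suc r') * rank_factor p r' n)"
      unfolding Suc power_Suc by (simp add: algebra_simps)
    also have "\<dots> = ?N ^ Suc n * rank_factor p r (Suc n)"
      unfolding Suc rank_factor_rec[OF p0] ..
    finally show ?thesis .
  qed
qed

section \<open>Generating tuples and the generator rank\<close>

lemma generate_Un_power_image_eq_carrier_iff:
  assumes S: "S \<subseteq> carrier G" and exp: "\<And>x. x \<in> carrier G \<Longrightarrow> x [^] (p ^ k :: nat) = \<one>"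
  shows "generate G (S \<union> power_image G p) = carrier G \<longleftrightarrow> generate G S = carrier G"
proof
  assume "generate G S = carrier G"
  moreover have "generate G S \<subseteq> generate G (S \<union> power_image G p)" by (rule mono_generate) simp
  moreover have "generate G (S \<union> power_image G p) \<subseteq> carrier G"
    using S power_image_subset by (intro generate_incl) simp
  ultimately show "generate G (S \<union> power_image G p) = carrier G" by simp
next
  assume h: "generate G (S \<union> power_image G p) = carrier G"
  have sub: "subgroup (generate G S) G" using S by (rule generate_is_subgroup)
  have "generate G S <#> power_image G p = generate G (power_image G p \<union> generate G S)"
    using generate_Un[OF sub subgroup_power_image] by (simp add: Un_commute)
  also have "\<dots> = generate G (S \<union> power_image G p)"
    using generate_Un_generate[OF power_image_subset S] by (simp add: Un_commute)
  finally show "generate G S = carrier G"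
    using eq_carrier_if_generates_mod_power_image[OF sub _ exp] h by simp
qed

text \<open>Adjoining the p-th powers does not affect generation, so the relative count applies with
  K = pG; its index equals the order of the p-torsion, which is p^r.\<close>

lemma card_generating_tuples:
  assumes fin: "finite (carrier G)" and p: "Factorial_Ring.prime p"
    and exp: "\<And>x. x \<in> carrier G \<Longrightarrow> x [^] (p ^ k :: nat) = \<one>"
    and rank: "card {x \<in> carrier G. x [^] p = \<one>} = p ^ r"
  shows "real (card (generating_tuples G n)) = real (card (carrier G)) ^ n * rank_factor p r n"
proof -
  have "generating_tuples G n = tuples_generating_mod G (power_image G p) n"
    unfolding generating_tuples_def tuples_generating_mod_def
    by (intro Collect_cong conj_cong refl) (simp only: generate_Un_power_image_eq_carrier_iff[OF _ exp])
  then show ?thesis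
    using card_tuples_generating_mod[OF fin p subgroup_power_image order_refl]
      card_power_image_torsion[OF fin, of p] rank by simp
qed

text \<open>The count of generating n-tuples is nonzero exactly when r \<le> n, as
  \<open>rank_factor\<close> vanishes only for n < r. It remains to pass between generating tuples
  and generating sets.\<close>

lemma generator_rank_eq:
  assumes fin: "finite (carrier G)" and p: "Factorial_Ring.prime p"
    and exp: "\<And>x. x \<in> carrier G \<Longrightarrow> x [^] (p ^ k :: nat) = \<one>"
    and rank: "card {x \<in> carrier G. x [^] p = \<one>} = p ^ r"
  shows "generator_rank G = r"
proof -
  have "card (carrier G) > 0" using fin one_closed by (metis card_gt_0_iff empty_iff)
  then have ne: "generating_tuples G n \<noteq> {} \<longleftrightarrow> r \<le> n" for n
  proof -
    have "generating_tuples G n \<subseteq> {xs. set xs \<subseteq> carrier G \<and> length xs = n}"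
      unfolding generating_tuples_def by auto
    then have "finite (generating_tuples G n)" by (rule finite_subset[OF _ finite_lists_length_eq[OF fin]])
    then have "generating_tuples G n \<noteq> {} \<longleftrightarrow> real (card (generating_tuples G n)) \<noteq> 0" by simp
    also have "real (card (generating_tuples G n)) = real (card (carrier G)) ^ n * rank_factor p r n"
      by (rule card_generating_tuples[OF fin p exp rank])
    also have "\<dots> \<noteq> 0 \<longleftrightarrow> rank_factor p r n \<noteq> 0"
      using \<open>card (carrier G) > 0\<close> by simp
    finally show ?thesis using rank_factor_pos_iff[OF prime_gt_1_nat[OF p]] by simp
  qed
  let ?P = "\<lambda>n. \<exists>S. finite S \<and> card S = n \<and> S \<subseteq> carrier G \<and> generate G S = carrier G"
  have lower: "r \<le> n" if P: "?P n" for n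
  proof -
    obtain S where S: "finite S" "card S = n" "S \<subseteq> carrier G" "generate G S = carrier G"
      using P by (elim exE conjE)
    obtain xs where "set xs = S" "length xs = n"
      using finite_distinct_list[OF S(1)] S(2) distinct_card by metis
    then have "xs \<in> generating_tuples G n" unfolding generating_tuples_def using S by simp
    then have "generating_tuples G n \<noteq> {}" by (rule ex_in_conv[THEN iffD1, OF exI])
    then show ?thesis by (rule ne[THEN iffD1])
  qed
  \<comment> \<open>A tuple of length r could a priori repeat entries; the lower bound applied to
    its set of entries forces exactly r of them.\<close>
  obtain xs where xs: "xs \<in> generating_tuples G r"
    using ne[of r] by (auto simp only: ex_in_conv[symmetric])
  then have P: "?P (card (set xs))" unfolding generating_tuples_def
    by (intro exI[of _ "set xs"]) simp
  then have "r \<le> card (set xs)" by (rule lower)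
  moreover have "card (set xs) \<le> r" using card_length[of xs] xs unfolding generating_tuples_def by simp
  ultimately have "?P r" using P by simp
  then show ?thesis unfolding generator_rank_def using lower by (intro Least_equality) auto
qed

end

section \<open>Products of cyclic groups\<close>

lemma power_image_iso:
  assumes h: "h \<in> iso G H" and "group G" "group H"
  shows "power_image H n = h ` power_image G n"
proof -
  have hom: "h \<in> hom G H" and img: "h ` carrier G = carrier H"
    using h by (auto simp: iso_def bij_betw_def)
  have "(\<lambda>y. y [^]\<^bsub>H\<^esub> n) ` h ` carrier G = h ` (\<lambda>x. x [^]\<^bsub>G\<^esub> n) ` carrier G"
    unfolding image_image
    by (rule image_cong[OF refl]) (rule hom_nat_pow[OF hom _ assms(2,3), symmetric])
  then show ?thesis unfolding power_image_def img .
qed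

lemma card_power_image_iso:
  assumes "G \<cong> H" and "group G" "group H"
  shows "card (power_image H n) = card (power_image G n)"
proof -
  obtain h where h: "h \<in> iso G H" using assms(1) unfolding is_iso_def by auto
  have "inj_on h (carrier G)" using h by (simp add: iso_def bij_betw_def)
  moreover have "power_image G n \<subseteq> carrier G"
    unfolding power_image_def using monoid.nat_pow_closed[OF group.is_monoid[OF assms(2)]] by auto
  ultimately have "inj_on h (power_image G n)" by (rule inj_on_subset)
  then show ?thesis unfolding power_image_iso[OF h assms(2,3)] by (rule card_image)
qed

text \<open>For k \<le> e the residue of p^k x modulo p^e depends only on x modulo p^(e-k). For k >
  e the image is {0}, and truncated subtraction gives the matching value p^0.\<close>

lemma card_power_image_integer_mod_group:
  assumes p: "p > 0"
  shows "card (power_image (integer_mod_group (p ^ e)) (p ^ k)) = p ^ (e - k)"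
proof -
  let ?f = "\<lambda>x. (int p ^ k * x) mod int p ^ e"
  have P: "power_image (integer_mod_group (p ^ e)) (p ^ k) = ?f ` {0..<int p ^ e}"
    unfolding power_image_def using p by (simp add: carrier_integer_mod_group)
  show ?thesis
  proof (cases "k \<le> e")
    case True
    let ?m = "int p ^ (e - k)"
    have e: "int p ^ e = int p ^ k * ?m" using True by (simp add: power_add[symmetric])
    have "?f ` {0..<int p ^ e} = (\<lambda>x. int p ^ k * x) ` (\<lambda>x. x mod ?m) ` {0..<int p ^ e}"
      unfolding image_image e by (rule image_cong[OF refl]) (simp only: mult_mod_right)
    also have "(\<lambda>x. x mod ?m) ` {0..<int p ^ e} = {0..<?m}"
    proof
      show "(\<lambda>x. x mod ?m) ` {0..<int p ^ e} \<subseteq> {0..<?m}" using p by auto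
      have "?m \<le> int p ^ e" using p by (intro power_increasing) auto
      then have "x = x mod ?m" "x \<in> {0..<int p ^ e}" if "x \<in> {0..<?m}" for x using that by auto
      then show "{0..<?m} \<subseteq> (\<lambda>x. x mod ?m) ` {0..<int p ^ e}" by (intro subsetI image_eqI)
    qed
    also have "card ((\<lambda>x. int p ^ k * x) ` {0..<?m}) = card {0..<?m}"
      using p by (intro card_image inj_onI) simp
    finally show ?thesis unfolding P by (simp add: nat_power_eq)
  next
    case False
    then have "int p ^ e dvd int p ^ k" by (intro le_imp_power_dvd) simp
    then have "?f x = 0" for x by (simp add: dvd_mult2)
    then have "?f ` {0..<int p ^ e} = (\<lambda>x. 0) ` {0..<int p ^ e}" by (intro image_cong refl)
    also have "\<dots> = {0}" using p by (intro image_constant[of 0]) simp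
    finally show ?thesis unfolding P using False by simp
  qed
qed

lemma pow_product_group:
  assumes "x \<in> carrier (product_group I G)"
  shows "x [^]\<^bsub>product_group I G\<^esub> (n::nat) = (\<lambda>i\<in>I. x i [^]\<^bsub>G i\<^esub> n)"
proof (induction n)
  case 0
  show ?case by (simp add: nat_pow_def)
next
  case (Suc n)
  then show ?case by (auto simp: nat_pow_def fun_eq_iff restrict_def)
qed

lemma power_image_product_group:
  "power_image (product_group I G) n = (\<Pi>\<^sub>E i\<in>I. power_image (G i) n)"
proof
  have "x [^]\<^bsub>product_group I G\<^esub> n \<in> (\<Pi>\<^sub>E i\<in>I. power_image (G i) n)"
    if "x \<in> carrier (product_group I G)" for x
    unfolding pow_product_group[OF that] power_image_def
    using that by (auto simp: PiE_iff)
  then show "power_image (product_group I G) n \<subseteq> (\<Pi>\<^sub>E i\<in>I. power_image (G i) n)"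
    unfolding power_image_def[of "product_group I G"] by (rule image_subsetI)
  show "(\<Pi>\<^sub>E i\<in>I. power_image (G i) n) \<subseteq> power_image (product_group I G) n"
  proof
    fix y assume y: "y \<in> (\<Pi>\<^sub>E i\<in>I. power_image (G i) n)"
    then have "\<forall>i\<in>I. \<exists>x. x \<in> carrier (G i) \<and> y i = x [^]\<^bsub>G i\<^esub> n"
      by (auto simp: power_image_def PiE_iff)
    then obtain x where x: "\<forall>i\<in>I. x i \<in> carrier (G i) \<and> y i = x i [^]\<^bsub>G i\<^esub> n"
      by (rule bchoice[THEN exE])
    let ?x = "restrict x I"
    have xc: "?x \<in> carrier (product_group I G)" using x by simp
    have "y i = (?x [^]\<^bsub>product_group I G\<^esub> n) i" for i
      unfolding pow_product_group[OF xc] using x y by (cases "i \<in> I") (auto simp: PiE_iff extensional_def)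
    then have "y = ?x [^]\<^bsub>product_group I G\<^esub> n" by (rule ext)
    then show "y \<in> power_image (product_group I G) n"
      unfolding power_image_def using xc by (rule image_eqI)
  qed
qed

lemma card_power_image_product:
  fixes n :: nat
  assumes p: "p > 0" and G: "group G"
    and iso: "G \<cong> product_group {..<n} (\<lambda>i. integer_mod_group (p ^ e i))"
  shows "card (power_image G (p ^ k)) = p ^ (\<Sum>i<n. e i - k)"
proof -
  have "group (product_group {..<n} (\<lambda>i. integer_mod_group (p ^ e i)))" by simp
  from card_power_image_iso[OF iso G this, of "p ^ k"]
  have "card (power_image G (p ^ k)) = card (\<Pi>\<^sub>E i\<in>{..<n}. power_image (integer_mod_group (p ^ e i)) (p ^ k))"
    by (simp only: power_image_product_group)
  also have "\<dots> = (\<Prod>i<n. p ^ (e i - k))"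
    by (simp add: card_PiE card_power_image_integer_mod_group[OF p])
  finally show ?thesis by (simp add: power_sum)
qed

section \<open>Truncated free abelian groups\<close>

lemma exists_free_Abelian_group_coeffs:
  fixes y :: "nat \<Rightarrow> int"
  shows "\<exists>f \<in> carrier (free_Abelian_group {..<g}). \<forall>i<g. Poly_Mapping.lookup f i = y i"
proof -
  define f where "f = Abs_poly_mapping (\<lambda>i. if i < g then y i else 0)"
  have "finite {i. (if i < g then y i else 0) \<noteq> 0}"
    by (rule finite_subset[of _ "{..<g}"]) auto
  then have l: "Poly_Mapping.lookup f i = (if i < g then y i else 0)" for i
    unfolding f_def by simp
  have "f \<in> carrier (free_Abelian_group {..<g})"
    by (auto simp: in_keys_iff l split: if_splits)
  then show ?thesis by (intro bexI[of _ f] allI impI) (simp add: l)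
qed

lemma free_Abelian_group_eqI:
  assumes "x \<in> carrier (free_Abelian_group S)" "y \<in> carrier (free_Abelian_group S)"
    and "\<And>i. i \<in> S \<Longrightarrow> Poly_Mapping.lookup x i = Poly_Mapping.lookup y i"
  shows "x = y"
proof (rule poly_mapping_eqI)
  fix i
  show "Poly_Mapping.lookup x i = Poly_Mapping.lookup y i"
  proof (cases "i \<in> S")
    case False
    then have "i \<notin> Poly_Mapping.keys x" "i \<notin> Poly_Mapping.keys y" using assms(1,2) by auto
    then show ?thesis by (simp add: in_keys_iff)
  qed (rule assms(3))
qed

definition residues_hom :: "nat \<Rightarrow> nat \<Rightarrow> (nat \<Rightarrow>\<^sub>0 int) \<Rightarrow> nat \<Rightarrow> int" where
  "residues_hom g m f = (\<lambda>i\<in>{..<g}. Poly_Mapping.lookup f i mod int m)"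

lemma residues_hom_image:
  assumes "m > 0"
  shows "residues_hom g m ` carrier (free_Abelian_group {..<g})
    = carrier (product_group {..<g} (\<lambda>_. integer_mod_group m))"
proof
  show "residues_hom g m ` carrier (free_Abelian_group {..<g})
    \<subseteq> carrier (product_group {..<g} (\<lambda>_. integer_mod_group m))"
    using assms by (intro image_subsetI) (simp add: residues_hom_def carrier_integer_mod_group)
  show "carrier (product_group {..<g} (\<lambda>_. integer_mod_group m))
    \<subseteq> residues_hom g m ` carrier (free_Abelian_group {..<g})"
  proof
    fix y assume y: "y \<in> carrier (product_group {..<g} (\<lambda>_. integer_mod_group m))"
    obtain f where f: "f \<in> carrier (free_Abelian_group {..<g})" "\<forall>i<g. Poly_Mapping.lookup f i = y i"
      using exists_free_Abelian_group_coeffs[of g y] by (elim bexE)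
    have "y i = residues_hom g m f i" for i
      using y f(2) assms
      by (cases "i < g") (auto simp: residues_hom_def carrier_integer_mod_group PiE_iff extensional_def)
    then have "y = residues_hom g m f" by (rule ext)
    then show "y \<in> residues_hom g m ` carrier (free_Abelian_group {..<g})" using f(1) by (rule image_eqI)
  qed
qed

lemma residues_hom_group_hom:
  assumes "m > 0"
  shows "group_hom (free_Abelian_group {..<g}) (product_group {..<g} (\<lambda>_. integer_mod_group m)) (residues_hom g m)"
proof -
  have "residues_hom g m \<in> hom (free_Abelian_group {..<g}) (product_group {..<g} (\<lambda>_. integer_mod_group m))"
  proof (rule homI)
    fix x assume "x \<in> carrier (free_Abelian_group {..<g})"
    then show "residues_hom g m x \<in> carrier (product_group {..<g} (\<lambda>_. integer_mod_group m))"
      unfolding residues_hom_image[OF assms, symmetric] by (rule imageI)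
  next
    fix x y
    show "residues_hom g m (x \<otimes>\<^bsub>free_Abelian_group {..<g}\<^esub> y)
      = residues_hom g m x \<otimes>\<^bsub>product_group {..<g} (\<lambda>_. integer_mod_group m)\<^esub> residues_hom g m y"
      by (auto simp: residues_hom_def lookup_add mod_simps fun_eq_iff)
  qed
  then show ?thesis by (simp add: group_hom_def group_hom_axioms_def)
qed

text \<open>If all coordinates are divisible by m, dividing them by m produces an m-th root in the
  free group.\<close>

lemma residues_hom_kernel:
  assumes "m > 0"
  shows "kernel (free_Abelian_group {..<g}) (product_group {..<g} (\<lambda>_. integer_mod_group m)) (residues_hom g m)
    = power_image (free_Abelian_group {..<g}) m" (is "?K = ?P")
proof
  show "?P \<subseteq> ?K"
  proof
    fix x assume "x \<in> ?P"
    then obtain z where z: "z \<in> carrier (free_Abelian_group {..<g})" "x = frag_cmul (int m) z"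
      unfolding power_image_def by auto
    then have "x \<in> carrier (free_Abelian_group {..<g})"
      by (simp add: subset_trans[OF keys_cmul])
    then show "x \<in> ?K" using z(2) by (auto simp: kernel_def residues_hom_def fun_eq_iff)
  qed
  show "?K \<subseteq> ?P"
  proof
    fix x assume x: "x \<in> ?K"
    then have xc: "x \<in> carrier (free_Abelian_group {..<g})" by (simp add: kernel_def)
    have "residues_hom g m x i = 0" if "i < g" for i
      using x that by (simp add: kernel_def)
    then have d: "int m dvd Poly_Mapping.lookup x i" if "i < g" for i
      using that by (auto simp: residues_hom_def)
    obtain f where f: "f \<in> carrier (free_Abelian_group {..<g})"
      "\<forall>i<g. Poly_Mapping.lookup f i = Poly_Mapping.lookup x i div int m"
      using exists_free_Abelian_group_coeffs[of g "\<lambda>i. Poly_Mapping.lookup x i div int m"] by (elim bexE)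
    have "x = frag_cmul (int m) f"
      using xc
    proof (rule free_Abelian_group_eqI)
      show "frag_cmul (int m) f \<in> carrier (free_Abelian_group {..<g})"
        using f(1) by (simp add: subset_trans[OF keys_cmul])
      show "Poly_Mapping.lookup x i = Poly_Mapping.lookup (frag_cmul (int m) f) i" if "i \<in> {..<g}" for i
        using f(2) that d by simp
    qed
    then show "x \<in> ?P" unfolding power_image_def using f(1) by (intro image_eqI) simp_all
  qed
qed

lemma Fab_trunc_eq:
  "Fab_trunc p g c = free_Abelian_group {..<g} Mod power_image (free_Abelian_group {..<g}) (p ^ c)"
  unfolding Fab_trunc_def comm_group.lower_p_central_eq[OF abelian_free_Abelian_group] ..

lemma comm_group_Fab_trunc: "comm_group (Fab_trunc p g c)"
  unfolding Fab_trunc_eq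
  by (intro comm_group.abelian_FactGroup comm_group.subgroup_power_image abelian_free_Abelian_group)

lemma Fab_trunc_iso_product:
  assumes "p > 0"
  shows "Fab_trunc p g c \<cong> product_group {..<g} (\<lambda>_. integer_mod_group (p ^ c))"
proof -
  have "p ^ c > 0" using assms by simp
  then show ?thesis unfolding Fab_trunc_eq residues_hom_kernel[symmetric, OF \<open>p ^ c > 0\<close>]
    by (intro group_hom.FactGroup_iso residues_hom_group_hom residues_hom_image)
qed

lemma normal_power_image: "comm_group G \<Longrightarrow> power_image G n \<lhd> G"
  by (simp add: comm_group.normal_iff_subgroup comm_group.subgroup_power_image)

section \<open>Homomorphisms out of the truncation\<close>

definition Fab_basis :: "nat \<Rightarrow> nat \<Rightarrow> nat \<Rightarrow> nat \<Rightarrow> (nat \<Rightarrow>\<^sub>0 int) set" where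
  "Fab_basis p g c i = power_image (free_Abelian_group {..<g}) (p ^ c) #>\<^bsub>free_Abelian_group {..<g}\<^esub> frag_of i"

lemma Fab_basis_closed: "i < g \<Longrightarrow> Fab_basis p g c i \<in> carrier (Fab_trunc p g c)"
  unfolding Fab_basis_def Fab_trunc_eq carrier_FactGroup by (intro imageI) simp

lemma Fab_trunc_exponent:
  assumes "x \<in> carrier (Fab_trunc p g c)"
  shows "x [^]\<^bsub>Fab_trunc p g c\<^esub> (p ^ c) = \<one>\<^bsub>Fab_trunc p g c\<^esub>"
proof -
  let ?F = "free_Abelian_group {..<g}"
  let ?N = "power_image ?F (p ^ c)"
  interpret F: comm_group ?F by (rule abelian_free_Abelian_group)
  interpret N: normal ?N ?F by (rule normal_power_image[OF abelian_free_Abelian_group])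
  obtain a where a: "a \<in> carrier ?F" "x = ?N #>\<^bsub>?F\<^esub> a"
    using assms unfolding Fab_trunc_eq carrier_FactGroup by (elim imageE)
  have "x [^]\<^bsub>?F Mod ?N\<^esub> (p ^ c) = ?N #>\<^bsub>?F\<^esub> (a [^]\<^bsub>?F\<^esub> (p ^ c))"
    unfolding a(2) by (rule N.FactGroup_pow[OF a(1)])
  also have "\<dots> = ?N"
    by (intro F.coset_join2 F.nat_pow_closed a(1) F.subgroup_power_image F.pow_in_power_image)
  finally show ?thesis unfolding Fab_trunc_eq one_FactGroup .
qed

text \<open>The truncation is free among abelian groups of exponent dividing p^c: the homomorphism
  from the free abelian group kills p^c-th powers and therefore descends to the quotient.\<close>

lemma Fab_trunc_hom_exists:
  fixes G :: "('a, 'b) monoid_scheme"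
  assumes G: "comm_group G" and exp: "\<And>x. x \<in> carrier G \<Longrightarrow> x [^]\<^bsub>G\<^esub> (p ^ c :: nat) = \<one>\<^bsub>G\<^esub>"
    and y: "\<And>i. i < g \<Longrightarrow> y i \<in> carrier G"
  shows "\<exists>h \<in> hom (Fab_trunc p g c) G. \<forall>i<g. h (Fab_basis p g c i) = y i"
proof -
  let ?F = "free_Abelian_group {..<g}"
  let ?N = "power_image ?F (p ^ c)"
  interpret G: comm_group G by (rule G)
  interpret F: comm_group ?F by (rule abelian_free_Abelian_group)
  have "y ` {..<g} \<subseteq> carrier G" using y by auto
  then obtain h where h: "h \<in> hom ?F G" "\<And>i. i \<in> {..<g} \<Longrightarrow> h (frag_of i) = y i"
    using G.free_Abelian_group_universal by metis
  have "h x = h z" if xz: "x \<in> carrier ?F" "z \<in> carrier ?F" and e: "?N #>\<^bsub>?F\<^esub> x = ?N #>\<^bsub>?F\<^esub> z" for x z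
  proof -
    have "x \<in> ?N #>\<^bsub>?F\<^esub> z"
      unfolding e[symmetric] by (rule F.rcos_self[OF xz(1) F.subgroup_power_image])
    then obtain w where w: "w \<in> carrier ?F" "x = w [^]\<^bsub>?F\<^esub> (p ^ c) \<otimes>\<^bsub>?F\<^esub> z"
      unfolding r_coset_def power_image_def by auto
    have "h x = h (w [^]\<^bsub>?F\<^esub> (p ^ c)) \<otimes>\<^bsub>G\<^esub> h z"
      unfolding w(2) by (rule hom_mult[OF h(1) F.nat_pow_closed[OF w(1)] xz(2)])
    also have "h (w [^]\<^bsub>?F\<^esub> (p ^ c)) = (h w) [^]\<^bsub>G\<^esub> (p ^ c)"
      by (rule hom_nat_pow[OF h(1) w(1) F.is_group G.is_group])
    also have "\<dots> = \<one>\<^bsub>G\<^esub>" by (rule exp[OF hom_in_carrier[OF h(1) w(1)]])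
    finally show ?thesis using hom_in_carrier[OF h(1) xz(2)] by simp
  qed
  then obtain h' where h': "h' \<in> hom (?F Mod ?N) G" "\<And>x. x \<in> carrier ?F \<Longrightarrow> h' (?N #>\<^bsub>?F\<^esub> x) = h x"
    using FactGroup_universal[OF h(1) normal_power_image[OF abelian_free_Abelian_group]] by metis
  have "h' (Fab_basis p g c i) = y i" if "i < g" for i
    unfolding Fab_basis_def using h'(2)[of "frag_of i"] h(2)[of i] that by simp
  then show ?thesis using h'(1) unfolding Fab_trunc_eq[symmetric] by (intro bexI[of _ h'] allI impI)
qed

text \<open>Pulled back along the coset map, both homomorphisms agree on the free generators, hence
  on all differences built from them.\<close>

lemma Fab_trunc_hom_unique:
  assumes G: "group G" and h: "h \<in> hom (Fab_trunc p g c) G" "h' \<in> hom (Fab_trunc p g c) G"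
    and e: "\<And>i. i < g \<Longrightarrow> h (Fab_basis p g c i) = h' (Fab_basis p g c i)"
    and x: "x \<in> carrier (Fab_trunc p g c)"
  shows "h x = h' x"
proof -
  let ?F = "free_Abelian_group {..<g}"
  let ?N = "power_image ?F (p ^ c)"
  interpret N: normal ?N ?F by (rule normal_power_image[OF abelian_free_Abelian_group])
  define k where "k = (\<lambda>f. h (?N #>\<^bsub>?F\<^esub> f))"
  define k' where "k' = (\<lambda>f. h' (?N #>\<^bsub>?F\<^esub> f))"
  have coset: "(\<lambda>f. ?N #>\<^bsub>?F\<^esub> f) \<in> hom ?F (Fab_trunc p g c)"
    unfolding Fab_trunc_eq by (rule N.r_coset_hom_Mod)
  have k: "group_hom ?F G k" "group_hom ?F G k'"
    using hom_compose[OF coset h(1)] hom_compose[OF coset h(2)] G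
    unfolding k_def k'_def by (simp_all add: group_hom_def group_hom_axioms_def comp_def)
  have "k f = k' f" if "Poly_Mapping.keys f \<subseteq> {..<g}" for f
    using that
  proof (rule free_Abelian_group_induct[where P = "\<lambda>f. k f = k' f"])
    show "k 0 = k' 0" using group_hom.hom_one[OF k(1)] group_hom.hom_one[OF k(2)] by simp
  next
    fix x y assume 2: "Poly_Mapping.keys x \<subseteq> {..<g}" "Poly_Mapping.keys y \<subseteq> {..<g}" "k x = k' x" "k y = k' y"
    have xy: "x \<in> carrier ?F" "y \<in> carrier ?F" using 2 by simp_all
    then have "x - y = x \<otimes>\<^bsub>?F\<^esub> inv\<^bsub>?F\<^esub> y" by simp
    moreover have "inv\<^bsub>?F\<^esub> y \<in> carrier ?F" using xy(2) by simp
    ultimately show "k (x - y) = k' (x - y)"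
      using 2 xy group_hom.hom_mult[OF k(1)] group_hom.hom_mult[OF k(2)]
        group_hom.hom_inv[OF k(1)] group_hom.hom_inv[OF k(2)] by metis
  next
    fix a assume "a \<in> {..<g}"
    then show "k (frag_of a) = k' (frag_of a)" using e[of a] unfolding k_def k'_def Fab_basis_def by simp
  qed
  moreover obtain f where "f \<in> carrier ?F" "x = ?N #>\<^bsub>?F\<^esub> f"
    using x unfolding Fab_trunc_eq carrier_FactGroup by (elim imageE)
  ultimately show ?thesis unfolding k_def k'_def by simp
qed

section \<open>Surjections and their kernels\<close>

lemma hom_image_power_image:
  assumes "group_hom A G h" "h ` carrier A = carrier G"
  shows "h ` power_image A n = power_image G n"
proof -
  have "h ` power_image A n = (\<lambda>y. y [^]\<^bsub>G\<^esub> n) ` h ` carrier A"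
    unfolding power_image_def image_image
    by (rule image_cong[OF refl]) (rule group_hom.hom_nat_pow[OF assms(1)])
  then show ?thesis unfolding assms(2) power_image_def .
qed

lemma (in group_hom) eq_iff_mem_kernel:
  assumes "a \<in> carrier G" "a' \<in> carrier G"
  shows "h a = h a' \<longleftrightarrow> a \<otimes> inv a' \<in> kernel G H h"
proof -
  have "h (a \<otimes> inv a') = h a \<otimes>\<^bsub>H\<^esub> inv\<^bsub>H\<^esub> h a'" using assms by simp
  then have "a \<otimes> inv a' \<in> kernel G H h \<longleftrightarrow> h a \<otimes>\<^bsub>H\<^esub> inv\<^bsub>H\<^esub> h a' = \<one>\<^bsub>H\<^esub>"
    using assms by (simp add: kernel_def)
  also have "\<dots> \<longleftrightarrow> h a = h a'"
    using assms H.inv_solve_right'[of "\<one>\<^bsub>H\<^esub>" "h a" "h a'"] by simp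
  finally show ?thesis by simp
qed

text \<open>For abelian \<open>A\<close> and a group \<open>G\<close> these are exactly the kernels
  of surjections from A to G, as the next two lemmas show.\<close>

definition kernels_onto :: "('a, 'b) monoid_scheme \<Rightarrow> ('c, 'd) monoid_scheme \<Rightarrow> 'a set set" where
  "kernels_onto A G = {N. subgroup N A \<and> (A Mod N) \<cong> G}"

lemma epi_of_kernels_onto:
  assumes A: "comm_group A" and G: "group G" and N: "N \<in> kernels_onto A G"
  obtains h where "group_hom A G h" "h ` carrier A = carrier G" "kernel A G h = N"
proof -
  interpret A: comm_group A by (rule A)
  have sN: "subgroup N A" using N by (simp add: kernels_onto_def)
  interpret N: normal N A using sN A.normal_iff_subgroup by simp
  obtain f where f: "f \<in> iso (A Mod N) G"
    using N unfolding kernels_onto_def is_iso_def by auto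
  have fh: "f \<in> hom (A Mod N) G" and fb: "bij_betw f (carrier (A Mod N)) (carrier G)"
    using f by (auto simp: iso_def)
  interpret M: group "A Mod N" by (rule N.factorgroup_is_group)
  define h where "h = (\<lambda>a. f (N #>\<^bsub>A\<^esub> a))"
  have hh: "group_hom A G h"
    using hom_compose[OF N.r_coset_hom_Mod fh] G A.is_group
    unfolding h_def by (simp add: group_hom_def group_hom_axioms_def comp_def)
  have "h ` carrier A = f ` carrier (A Mod N)"
    unfolding h_def carrier_FactGroup image_image ..
  then have im: "h ` carrier A = carrier G" using fb by (simp add: bij_betw_def)
  have "h a = \<one>\<^bsub>G\<^esub> \<longleftrightarrow> a \<in> N" if a: "a \<in> carrier A" for a
  proof -
    have "f N = \<one>\<^bsub>G\<^esub>" using hom_one[OF fh M.is_group G] by simp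
    moreover have "N #>\<^bsub>A\<^esub> a \<in> carrier (A Mod N)" unfolding carrier_FactGroup using a by (rule imageI)
    moreover have "N \<in> carrier (A Mod N)" using M.one_closed by simp
    ultimately have "h a = \<one>\<^bsub>G\<^esub> \<longleftrightarrow> N #>\<^bsub>A\<^esub> a = N"
      unfolding h_def using fb by (metis bij_betw_def inj_on_eq_iff)
    also have "\<dots> \<longleftrightarrow> a \<in> N"
      using A.coset_join1[OF _ a sN] A.coset_join2[OF a sN] by metis
    finally show ?thesis .
  qed
  then have "kernel A G h = N" using N.subset by (auto simp: kernel_def)
  with hh im show ?thesis by (rule that)
qed

lemma kernel_in_kernels_onto:
  assumes "group_hom A G h" "h ` carrier A = carrier G"
  shows "kernel A G h \<in> kernels_onto A G"
  unfolding kernels_onto_def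
  using group_hom.subgroup_kernel[OF assms(1)] group_hom.FactGroup_iso[OF assms] by simp

text \<open>The surjections with a given kernel form a torsor under the automorphism group of the target.\<close>
lemma exists_automorphism_between_epis:
  assumes h0: "group_hom A G h0" "h0 ` carrier A = carrier G"
    and h: "group_hom A G h" "h ` carrier A = carrier G"
    and ker: "kernel A G h0 = kernel A G h"
  shows "\<exists>\<alpha> \<in> iso G G. \<forall>a\<in>carrier A. \<alpha> (h0 a) = h a"
proof -
  interpret h0: group_hom A G h0 by (rule h0)
  interpret h: group_hom A G h by (rule h)
  \<comment> \<open>A set-theoretic section of h0. Equal kernels mean that h0 and h identify the
    same pairs, so h after s does not depend on the chosen preimages.\<close>
  define s where "s = (\<lambda>x. SOME a. a \<in> carrier A \<and> h0 a = x)"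
  have s: "s x \<in> carrier A \<and> h0 (s x) = x" if "x \<in> carrier G" for x
  proof -
    have "x \<in> h0 ` carrier A" using that h0(2) by simp
    then have "\<exists>a. a \<in> carrier A \<and> h0 a = x" by auto
    then show ?thesis unfolding s_def by (rule someI_ex)
  qed
  have eq: "h0 a = h0 a' \<longleftrightarrow> h a = h a'" if "a \<in> carrier A" "a' \<in> carrier A" for a a'
    using h0.eq_iff_mem_kernel[OF that] h.eq_iff_mem_kernel[OF that] ker by simp
  define \<alpha> where "\<alpha> = (\<lambda>x. h (s x))"
  have \<alpha>: "\<alpha> (h0 a) = h a" if "a \<in> carrier A" for a
    unfolding \<alpha>_def using s[of "h0 a"] eq[of "s (h0 a)" a] that by simp
  have "\<alpha> \<in> hom G G"
  proof (rule homI)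
    show "\<alpha> x \<in> carrier G" if "x \<in> carrier G" for x
      unfolding \<alpha>_def using s[OF that] by simp
    fix x y assume xy: "x \<in> carrier G" "y \<in> carrier G"
    then have "x \<otimes>\<^bsub>G\<^esub> y = h0 (s x \<otimes>\<^bsub>A\<^esub> s y)" using s by simp
    then have "\<alpha> (x \<otimes>\<^bsub>G\<^esub> y) = h (s x \<otimes>\<^bsub>A\<^esub> s y)"
      using \<alpha>[of "s x \<otimes>\<^bsub>A\<^esub> s y"] s xy by (simp only: h0.G.m_closed)
    also have "\<dots> = h (s x) \<otimes>\<^bsub>G\<^esub> h (s y)" using s xy by simp
    finally show "\<alpha> (x \<otimes>\<^bsub>G\<^esub> y) = \<alpha> x \<otimes>\<^bsub>G\<^esub> \<alpha> y" by (simp only: \<alpha>_def)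
  qed
  moreover have "bij_betw \<alpha> (carrier G) (carrier G)"
  proof (rule bij_betw_imageI)
    show "inj_on \<alpha> (carrier G)"
    proof (rule inj_onI)
      fix x y assume "x \<in> carrier G" "y \<in> carrier G" "\<alpha> x = \<alpha> y"
      then show "x = y" using eq[of "s x" "s y"] s unfolding \<alpha>_def by metis
    qed
    have "\<alpha> ` h0 ` carrier A = h ` carrier A" unfolding image_image using \<alpha> by (intro image_cong refl)
    then show "\<alpha> ` carrier G = carrier G" using h0(2) h(2) by simp
  qed
  ultimately have "\<alpha> \<in> iso G G" by (rule isoI)
  then show ?thesis using \<alpha> by (intro bexI[of _ \<alpha>] ballI)
qed

section \<open>Surjections as generating tuples\<close>

text \<open>The projection modulo the subgroup generated by the basis agrees with the trivial
  homomorphism on the basis, so by uniqueness it is trivial.\<close>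

lemma Fab_basis_generate: "generate (Fab_trunc p g c) (Fab_basis p g c ` {..<g}) = carrier (Fab_trunc p g c)"
proof -
  let ?A = "Fab_trunc p g c"
  let ?H = "generate ?A (Fab_basis p g c ` {..<g})"
  interpret A: comm_group ?A by (rule comm_group_Fab_trunc)
  have sub: "Fab_basis p g c ` {..<g} \<subseteq> carrier ?A" using Fab_basis_closed by auto
  have sH: "subgroup ?H ?A" by (rule A.generate_is_subgroup[OF sub])
  interpret H: normal ?H ?A using sH by (simp add: A.normal_iff_subgroup)
  have M: "group (?A Mod ?H)" by (rule H.factorgroup_is_group)
  have "x \<in> ?H" if x: "x \<in> carrier ?A" for x
  proof -
    have "?H #>\<^bsub>?A\<^esub> x = \<one>\<^bsub>?A Mod ?H\<^esub>"
    proof (rule Fab_trunc_hom_unique[OF M H.r_coset_hom_Mod _ _ x])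
      show "(\<lambda>x. \<one>\<^bsub>?A Mod ?H\<^esub>) \<in> hom ?A (?A Mod ?H)"
        using monoid.one_closed[OF group.is_monoid[OF M]] monoid.l_one[OF group.is_monoid[OF M]]
        by (intro homI) simp_all
      fix i assume "i < g"
      then have "Fab_basis p g c i \<in> ?H" by (intro generate.incl imageI) simp
      then show "?H #>\<^bsub>?A\<^esub> Fab_basis p g c i = \<one>\<^bsub>?A Mod ?H\<^esub>"
        using A.coset_join2[OF Fab_basis_closed[OF \<open>i < g\<close>] sH] by simp
    qed
    then show ?thesis using A.coset_join1[OF _ x sH] by simp
  qed
  then show ?thesis using H.subset by blast
qed

lemma Fab_hom_image_eq_generate:
  assumes h: "group_hom (Fab_trunc p g c) G h"
  shows "h ` carrier (Fab_trunc p g c) = generate G (set (map (\<lambda>i. h (Fab_basis p g c i)) [0..<g]))"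
proof -
  have "Fab_basis p g c ` {..<g} \<subseteq> carrier (Fab_trunc p g c)" using Fab_basis_closed by auto
  from group_hom.generate_img[OF h this]
  show ?thesis unfolding Fab_basis_generate by (simp add: image_image lessThan_atLeast0)
qed

text \<open>Evaluation at the basis matches surjections onto G with generating g-tuples. Grouping
  these by kernel gives one class per element of \<open>kernels_onto\<close>, each of size |Aut(G)|
  by the torsor property.\<close>

lemma card_generating_tuples_eq_card_kernels:
  fixes G :: "('a, 'b) monoid_scheme"
  assumes G: "comm_group G" and finG: "finite (carrier G)" and finA: "finite (carrier (Fab_trunc p g c))"
    and exp: "\<And>x. x \<in> carrier G \<Longrightarrow> x [^]\<^bsub>G\<^esub> (p ^ c :: nat) = \<one>\<^bsub>G\<^esub>"
  shows "card (generating_tuples G g) = card (kernels_onto (Fab_trunc p g c) G) * card_Aut G"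
proof -
  let ?A = "Fab_trunc p g c"
  let ?b = "Fab_basis p g c"
  let ?K = "kernels_onto ?A G"
  interpret A: comm_group ?A by (rule comm_group_Fab_trunc)
  interpret G: comm_group G by (rule G)
  \<comment> \<open>Homomorphisms are HOL functions with arbitrary values off the carrier, so they
    are counted through their tuples of basis values.\<close>
  define ev where "ev = (\<lambda>h::_ \<Rightarrow> 'a. map (\<lambda>i. h (?b i)) [0..<g])"
  define epi where "epi = (\<lambda>h. group_hom ?A G h \<and> h ` carrier ?A = carrier G)"
  define fib where "fib = (\<lambda>N. {ev h | h. epi h \<and> kernel ?A G h = N})"
  have ev_eqD: "h a = h' a"
    if hs: "group_hom ?A G h" "group_hom ?A G h'" and e: "ev h = ev h'" and a: "a \<in> carrier ?A" for h h' a
  proof (rule Fab_trunc_hom_unique[OF G.is_group group_hom.homh[OF hs(1)] group_hom.homh[OF hs(2)] _ a])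
    fix i assume "i < g"
    then show "h (?b i) = h' (?b i)" using arg_cong[OF e, of "\<lambda>l. l ! i"] by (simp add: ev_def)
  qed
  have ker_eq: "kernel ?A G h = kernel ?A G h'"
    if hs: "group_hom ?A G h" "group_hom ?A G h'" and e: "ev h = ev h'" for h h'
    unfolding kernel_def using ev_eqD[OF hs e] by (intro Collect_cong conj_cong refl) simp
  have T: "generating_tuples G g = (\<Union>N\<in>?K. fib N)"
  proof
    show "generating_tuples G g \<subseteq> (\<Union>N\<in>?K. fib N)"
    proof
      fix y assume "y \<in> generating_tuples G g"
      then have y: "length y = g" "set y \<subseteq> carrier G" "generate G (set y) = carrier G"
        by (simp_all add: generating_tuples_def)
      have yc: "y ! i \<in> carrier G" if "i < g" for i using y(1,2) nth_mem[of i y] that by auto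
      have "\<exists>h\<in>hom ?A G. \<forall>i<g. h (?b i) = y ! i"
        by (rule Fab_trunc_hom_exists[OF G]) (simp_all add: exp yc)
      then obtain h where h: "h \<in> hom ?A G" "\<forall>i<g. h (?b i) = y ! i" by (elim bexE)
      have hh: "group_hom ?A G h"
        using h(1) by (simp add: group_hom_def group_hom_axioms_def A.is_group G.is_group)
      have ev: "ev h = y" unfolding ev_def using y(1) h(2) by (intro nth_equalityI) simp_all
      have "epi h" unfolding epi_def
        using hh Fab_hom_image_eq_generate[OF hh] ev y(3) unfolding ev_def by simp
      then show "y \<in> (\<Union>N\<in>?K. fib N)"
        using ev kernel_in_kernels_onto[of ?A G h] unfolding epi_def fib_def by auto
    qed
    show "(\<Union>N\<in>?K. fib N) \<subseteq> generating_tuples G g"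
    proof (rule UN_least, rule subsetI)
      fix N y assume "y \<in> fib N"
      then obtain h where h: "epi h" "y = ev h" unfolding fib_def by auto
      then have hh: "group_hom ?A G h" "h ` carrier ?A = carrier G" by (simp_all add: epi_def)
      have "generate G (set y) = carrier G"
        using Fab_hom_image_eq_generate[OF hh(1)] hh(2) h(2) unfolding ev_def by simp
      moreover have "set y \<subseteq> carrier G"
        unfolding h(2) ev_def using group_hom.hom_closed[OF hh(1) Fab_basis_closed] by auto
      ultimately show "y \<in> generating_tuples G g"
        unfolding generating_tuples_def using h(2) by (simp add: ev_def)
    qed
  qed
  have cardfib: "card (fib N) = card_Aut G" if N: "N \<in> ?K" for N
  proof -
    obtain h0 where h0: "group_hom ?A G h0" "h0 ` carrier ?A = carrier G" "kernel ?A G h0 = N"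
      using epi_of_kernels_onto[OF comm_group_Fab_trunc G.is_group N] .
    interpret h0: group_hom ?A G h0 by (rule h0)
    \<comment> \<open>Restricting makes each automorphism a single function, which the injectivity
      of evaluation needs and which agrees with \<open>card_Aut\<close>.\<close>
    let ?R = "(\<lambda>f. restrict f (carrier G)) ` iso G G"
    have comp: "group_hom ?A G (\<alpha> \<circ> h0)" if "\<alpha> \<in> hom G G" for \<alpha>
      using hom_compose[OF h0.homh that] by (simp add: group_hom_def group_hom_axioms_def A.is_group G.is_group)
    have R: "\<alpha> \<in> iso G G" if \<alpha>: "\<alpha> \<in> ?R" for \<alpha>
    proof -
      obtain f where f: "f \<in> iso G G" "\<alpha> = restrict f (carrier G)" using \<alpha> by auto
      then show ?thesis unfolding iso_def
        by (auto intro: G.hom_restrict cong: bij_betw_cong)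
    qed
    have inj: "inj_on (\<lambda>\<alpha>. ev (\<alpha> \<circ> h0)) ?R"
    proof (rule inj_onI)
      fix \<alpha> \<beta> assume ab: "\<alpha> \<in> ?R" "\<beta> \<in> ?R" and e: "ev (\<alpha> \<circ> h0) = ev (\<beta> \<circ> h0)"
      have hom: "\<alpha> \<in> hom G G" "\<beta> \<in> hom G G" using R[OF ab(1)] R[OF ab(2)] by (simp_all add: iso_def)
      have "\<alpha> x = \<beta> x" if "x \<in> carrier G" for x
      proof -
        obtain a where "a \<in> carrier ?A" "x = h0 a" using \<open>x \<in> carrier G\<close> unfolding h0(2)[symmetric] by (elim imageE)
        then show ?thesis using ev_eqD[OF comp[OF hom(1)] comp[OF hom(2)] e] by simp
      qed
      moreover have "\<alpha> \<in> extensional (carrier G)" "\<beta> \<in> extensional (carrier G)" using ab by auto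
      ultimately show "\<alpha> = \<beta>" by (intro extensionalityI)
    qed
    have "(\<lambda>\<alpha>. ev (\<alpha> \<circ> h0)) ` ?R = fib N"
    proof
      show "(\<lambda>\<alpha>. ev (\<alpha> \<circ> h0)) ` ?R \<subseteq> fib N"
      proof (rule image_subsetI)
        fix \<alpha> assume "\<alpha> \<in> ?R"
        from R[OF this] have \<alpha>: "\<alpha> \<in> hom G G" "bij_betw \<alpha> (carrier G) (carrier G)"
          by (simp_all add: iso_def)
        have one: "\<alpha> \<one>\<^bsub>G\<^esub> = \<one>\<^bsub>G\<^esub>" using hom_one[OF \<alpha>(1) G.is_group G.is_group] .
        have "\<alpha> x = \<one>\<^bsub>G\<^esub> \<longleftrightarrow> x = \<one>\<^bsub>G\<^esub>" if "x \<in> carrier G" for x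
          using \<alpha>(2) one that G.one_closed unfolding bij_betw_def by (metis inj_on_eq_iff)
        then have "kernel ?A G (\<alpha> \<circ> h0) = N"
          unfolding h0(3)[symmetric] kernel_def by (intro Collect_cong conj_cong refl) simp
        moreover have "epi (\<alpha> \<circ> h0)"
          unfolding epi_def image_comp[symmetric] h0(2)
          using comp[OF \<alpha>(1)] \<alpha>(2) by (simp add: bij_betw_def)
        ultimately show "ev (\<alpha> \<circ> h0) \<in> fib N"
          unfolding fib_def by (intro CollectI exI[of _ "\<alpha> \<circ> h0"] conjI refl)
      qed
      show "fib N \<subseteq> (\<lambda>\<alpha>. ev (\<alpha> \<circ> h0)) ` ?R"
      proof
        fix y assume "y \<in> fib N"
        then obtain h where h: "epi h" "kernel ?A G h = N" "y = ev h" unfolding fib_def by auto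
        then have hh: "group_hom ?A G h" "h ` carrier ?A = carrier G" by (simp_all add: epi_def)
        have "kernel ?A G h0 = kernel ?A G h" using h(2) h0(3) by simp
        from exists_automorphism_between_epis[OF h0(1,2) hh this]
        obtain \<alpha> where \<alpha>: "\<alpha> \<in> iso G G" "\<forall>a\<in>carrier ?A. \<alpha> (h0 a) = h a" by (elim bexE)
        have "y = ev (restrict \<alpha> (carrier G) \<circ> h0)"
          unfolding h(3) ev_def using \<alpha>(2) Fab_basis_closed by (intro map_cong refl) simp
        then show "y \<in> (\<lambda>\<alpha>. ev (\<alpha> \<circ> h0)) ` ?R"
          using \<alpha>(1) by (intro image_eqI[of _ _ "restrict \<alpha> (carrier G)"] imageI)
      qed
    qed
    then show ?thesis using card_image[OF inj] unfolding card_Aut_def by simp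
  qed
  have finT: "finite (generating_tuples G g)"
    by (rule finite_subset[OF _ finite_lists_length_eq[OF finG, of g]]) (auto simp: generating_tuples_def)
  have finfib: "finite (fib N)" if "N \<in> ?K" for N
    by (rule finite_subset[OF UN_upper[OF that] finT[unfolded T]])
  have finK: "finite ?K"
    by (rule finite_subset[of _ "Pow (carrier ?A)"]) (use finA subgroup.subset in \<open>auto simp: kernels_onto_def\<close>)
  have disj: "fib N \<inter> fib M = {}" if NM: "N \<noteq> M" for N M
  proof (rule ccontr)
    assume "fib N \<inter> fib M \<noteq> {}"
    then obtain y where "y \<in> fib N" "y \<in> fib M" by auto
    then obtain h h' where "epi h" "kernel ?A G h = N" "epi h'" "kernel ?A G h' = M" "ev h = ev h'"
      unfolding fib_def by auto
    then show False using ker_eq[of h h'] NM unfolding epi_def by simp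
  qed
  have "card (generating_tuples G g) = (\<Sum>N\<in>?K. card (fib N))"
    unfolding T using finK finfib disj by (intro card_UN_disjoint ballI impI)
  then show ?thesis using cardfib by simp
qed

section \<open>The measure\<close>

lemma generating_tuples_subgroup:
  assumes "group G" "subgroup H G"
  shows "generating_tuples (G\<lparr>carrier := H\<rparr>) n = {xs. length xs = n \<and> set xs \<subseteq> H \<and> generate G (set xs) = H}"
proof -
  have "generate (G\<lparr>carrier := H\<rparr>) (set xs) = generate G (set xs)" if "set xs \<subseteq> H" for xs
    by (rule group.generate_consistent[OF assms(1) that assms(2)])
  then show ?thesis unfolding generating_tuples_def by (intro Collect_cong conj_cong refl) simp_all
qed

lemma card_generating_tuples_subgroup:
  assumes G: "comm_group G" and H: "subgroup H G" and fin: "finite (carrier G)"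
    and p: "Factorial_Ring.prime p"
    and exp: "\<And>x. x \<in> carrier G \<Longrightarrow> x [^]\<^bsub>G\<^esub> (p ^ k :: nat) = \<one>\<^bsub>G\<^esub>"
    and rank: "card {x \<in> H. x [^]\<^bsub>G\<^esub> p = \<one>\<^bsub>G\<^esub>} = p ^ r"
  shows "real (card (generating_tuples (G\<lparr>carrier := H\<rparr>) n)) = real (card H) ^ n * rank_factor p r n"
proof -
  interpret G: comm_group G by (rule G)
  let ?H = "G\<lparr>carrier := H\<rparr>"
  have HG: "H \<subseteq> carrier G" using H by (rule subgroup.subset)
  have pow: "x [^]\<^bsub>?H\<^esub> m = x [^]\<^bsub>G\<^esub> m" for x and m :: nat
    by (rule G.nat_pow_consistent[symmetric])
  have "comm_group ?H"
  proof (rule group.group_comm_groupI[OF G.subgroup_imp_group[OF H]])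
    fix x y assume "x \<in> carrier ?H" "y \<in> carrier ?H"
    then have "x \<in> carrier G" "y \<in> carrier G" using HG by auto
    then show "x \<otimes>\<^bsub>?H\<^esub> y = y \<otimes>\<^bsub>?H\<^esub> x" by (simp add: G.m_comm)
  qed
  moreover have "finite (carrier ?H)" using finite_subset[OF HG fin] by simp
  moreover have "x [^]\<^bsub>?H\<^esub> (p ^ k) = \<one>\<^bsub>?H\<^esub>" if "x \<in> carrier ?H" for x
    unfolding pow using exp[of x] subsetD[OF HG, of x] that by simp
  moreover have "card {x \<in> carrier ?H. x [^]\<^bsub>?H\<^esub> p = \<one>\<^bsub>?H\<^esub>} = p ^ r"
    unfolding pow using rank by simp
  ultimately have "real (card (generating_tuples ?H n)) = real (card (carrier ?H)) ^ n * rank_factor p r n"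
    using p comm_group.card_generating_tuples by blast
  then show ?thesis by simp
qed

text \<open>A presenting tuple belongs to the N it generates. Conversely, a tuple generating such an
  N has its entries in the Frattini subgroup, because N lies there by assumption.\<close>

lemma presenting_tuples_eq:
  assumes sub: "\<And>N. N \<in> kernels_onto (Fab_trunc p g c) G \<Longrightarrow> N \<subseteq> frattini (Fab_trunc p g c)"
  shows "presenting_tuples p g c G
    = (\<Union>N\<in>kernels_onto (Fab_trunc p g c) G. generating_tuples ((Fab_trunc p g c)\<lparr>carrier := N\<rparr>) (g + 1))"
proof -
  let ?A = "Fab_trunc p g c"
  interpret A: comm_group ?A by (rule comm_group_Fab_trunc)
  have fr: "frattini ?A \<subseteq> carrier ?A" unfolding frattini_def by simp
  show ?thesis
  proof
    show "presenting_tuples p g c G \<subseteq> (\<Union>N\<in>kernels_onto ?A G. generating_tuples (?A\<lparr>carrier := N\<rparr>) (g + 1))"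
    proof
      fix v assume "v \<in> presenting_tuples p g c G"
      then have v: "length v = g + 1" "set v \<subseteq> frattini ?A" "(?A Mod generate ?A (set v)) \<cong> G"
        unfolding presenting_tuples_def by simp_all
      let ?N = "generate ?A (set v)"
      have vc: "set v \<subseteq> carrier ?A" using v(2) fr by (rule subset_trans)
      have sN: "subgroup ?N ?A" by (rule A.generate_is_subgroup[OF vc])
      have "?N \<in> kernels_onto ?A G" unfolding kernels_onto_def using sN v(3) by simp
      moreover have "v \<in> generating_tuples (?A\<lparr>carrier := ?N\<rparr>) (g + 1)"
        unfolding generating_tuples_subgroup[OF A.is_group sN] using v(1) by (auto intro: generate.incl)
      ultimately show "v \<in> (\<Union>N\<in>kernels_onto ?A G. generating_tuples (?A\<lparr>carrier := N\<rparr>) (g + 1))"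
        by (rule UN_I)
    qed
    show "(\<Union>N\<in>kernels_onto ?A G. generating_tuples (?A\<lparr>carrier := N\<rparr>) (g + 1)) \<subseteq> presenting_tuples p g c G"
    proof (rule UN_least, rule subsetI)
      fix N v assume N: "N \<in> kernels_onto ?A G" and v: "v \<in> generating_tuples (?A\<lparr>carrier := N\<rparr>) (g + 1)"
      have sN: "subgroup N ?A" and iso: "(?A Mod N) \<cong> G" using N by (simp_all add: kernels_onto_def)
      have "length v = g + 1" "set v \<subseteq> N" "generate ?A (set v) = N"
        using v unfolding generating_tuples_subgroup[OF A.is_group sN] by simp_all
      then show "v \<in> presenting_tuples p g c G"
        unfolding presenting_tuples_def using sub[OF N] iso by simp
    qed
  qed
qed

lemma card_presenting_tuples:
  assumes sub: "\<And>N. N \<in> kernels_onto (Fab_trunc p g c) G \<Longrightarrow> N \<subseteq> frattini (Fab_trunc p g c)"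
    and fin: "finite (carrier (Fab_trunc p g c))"
  shows "card (presenting_tuples p g c G)
    = (\<Sum>N\<in>kernels_onto (Fab_trunc p g c) G. card (generating_tuples ((Fab_trunc p g c)\<lparr>carrier := N\<rparr>) (g + 1)))"
proof -
  let ?A = "Fab_trunc p g c"
  let ?T = "\<lambda>N. generating_tuples (?A\<lparr>carrier := N\<rparr>) (g + 1)"
  interpret A: comm_group ?A by (rule comm_group_Fab_trunc)
  have s: "subgroup N ?A" if "N \<in> kernels_onto ?A G" for N using that by (simp add: kernels_onto_def)
  have finK: "finite (kernels_onto ?A G)"
    by (rule finite_subset[of _ "Pow (carrier ?A)"]) (use fin subgroup.subset in \<open>auto simp: kernels_onto_def\<close>)
  have finT: "finite (?T N)" if "N \<in> kernels_onto ?A G" for N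
  proof (rule finite_subset)
    show "?T N \<subseteq> {xs. set xs \<subseteq> N \<and> length xs = g + 1}" by (auto simp: generating_tuples_def)
    show "finite {xs. set xs \<subseteq> N \<and> length xs = g + 1}"
      by (rule finite_lists_length_eq[OF finite_subset[OF subgroup.subset[OF s[OF that]] fin]])
  qed
  have disj: "?T N \<inter> ?T M = {}" if "N \<in> kernels_onto ?A G" "M \<in> kernels_onto ?A G" "N \<noteq> M" for N M
    unfolding generating_tuples_subgroup[OF A.is_group s[OF that(1)]]
      generating_tuples_subgroup[OF A.is_group s[OF that(2)]] using that(3) by auto
  have "presenting_tuples p g c G = (\<Union>N\<in>kernels_onto ?A G. ?T N)"
    by (rule presenting_tuples_eq) (rule sub)
  then show ?thesis
    by (simp only:) (rule card_UN_disjoint, use finK finT disj in simp_all)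
qed

section \<open>Orders, torsion and kernels at one truncation level\<close>

context
  fixes p g c :: nat
  assumes p: "Factorial_Ring.prime p"
begin

lemma card_power_image_Fab_trunc:
  "card (power_image (Fab_trunc p g c) (p ^ k)) = p ^ (g * (c - k))"
  using card_power_image_product[OF prime_gt_0_nat[OF p]
      comm_group.axioms(2)[OF comm_group_Fab_trunc] Fab_trunc_iso_product[OF prime_gt_0_nat[OF p]]]
  by simp

lemma card_Fab_trunc: "card (carrier (Fab_trunc p g c)) = p ^ (g * c)"
proof -
  have "power_image (Fab_trunc p g c) (p ^ 0) = carrier (Fab_trunc p g c)"
    using comm_group.lower_p_central_eq[OF comm_group_Fab_trunc, of p g c p 0] by simp
  then show ?thesis using card_power_image_Fab_trunc[of 0] by simp
qed

lemma finite_Fab_trunc: "finite (carrier (Fab_trunc p g c))"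
  \<comment> \<open>An infinite set has \<open>card\<close> 0, so the positive value already gives
    finiteness.\<close>
  using card_Fab_trunc prime_gt_0_nat[OF p] by (intro card_ge_0_finite) simp

lemma frattini_Fab_trunc: "frattini (Fab_trunc p g c) = power_image (Fab_trunc p g c) p"
  by (rule comm_group.frattini_eq[OF comm_group_Fab_trunc finite_Fab_trunc p Fab_trunc_exponent])

text \<open>The p^(c-1)-th powers are killed by p, and both sides have order p^g, so the inclusion
  is an equality.\<close>

lemma torsion_Fab_trunc:
  assumes "c \<ge> 1"
  shows "{x \<in> carrier (Fab_trunc p g c). x [^]\<^bsub>Fab_trunc p g c\<^esub> p = \<one>\<^bsub>Fab_trunc p g c\<^esub>}
      = power_image (Fab_trunc p g c) (p ^ (c - 1))" (is "?T = ?P")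
    and "card {x \<in> carrier (Fab_trunc p g c). x [^]\<^bsub>Fab_trunc p g c\<^esub> p = \<one>\<^bsub>Fab_trunc p g c\<^esub>} = p ^ g"
proof -
  let ?A = "Fab_trunc p g c"
  interpret A: comm_group ?A by (rule comm_group_Fab_trunc)
  have p0: "p > 0" using p by (rule prime_gt_0_nat)
  have "g * c = g * (c - 1) + g" using assms by (cases c) simp_all
  then have "p ^ (g * (c - 1)) * p ^ g = p ^ (g * (c - 1)) * card ?T"
    using A.card_power_image_torsion[OF finite_Fab_trunc, of p]
      card_power_image_Fab_trunc[of 1] card_Fab_trunc by (simp add: power_add)
  then show T: "card ?T = p ^ g" using p0 by simp
  have P: "card ?P = p ^ g" using card_power_image_Fab_trunc[of "c - 1"] assms by simp
  have "p ^ (c - 1) * p = p ^ c" using assms by (cases c) simp_all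
  then have "(a [^]\<^bsub>?A\<^esub> (p ^ (c - 1))) [^]\<^bsub>?A\<^esub> p = \<one>\<^bsub>?A\<^esub>" if "a \<in> carrier ?A" for a
    using A.nat_pow_pow[OF that, of "p ^ (c - 1)" p] Fab_trunc_exponent[OF that] by simp
  then have "?P \<subseteq> ?T" unfolding power_image_def by auto
  moreover have "finite ?T" using finite_Fab_trunc by simp
  ultimately show "?T = ?P" using card_subset_eq[of ?T ?P] T P by simp
qed

lemma card_mult_card_of_kernels_onto:
  assumes G: "group G" and N: "N \<in> kernels_onto (Fab_trunc p g c) G"
  shows "card (carrier G) * card N = p ^ (g * c)"
proof -
  obtain h where h: "group_hom (Fab_trunc p g c) G h" "h ` carrier (Fab_trunc p g c) = carrier G"
    "kernel (Fab_trunc p g c) G h = N"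
    using epi_of_kernels_onto[OF comm_group_Fab_trunc G N] .
  then show ?thesis
    using group_hom.card_image_kernel[OF h(1) finite_Fab_trunc] card_Fab_trunc by simp
qed

text \<open>The preimage of the \<open>p\<close>-th powers of \<open>G\<close> contains the \<open>p\<close>-th powers of \<open>Fab_trunc p g c\<close> and
  has the same order, since both quotients have order \<open>p ^ g\<close>.\<close>
lemma kernels_onto_subset_power_image:
  assumes G: "comm_group G" and c: "c \<ge> 1" and N: "N \<in> kernels_onto (Fab_trunc p g c) G"
    and rank: "card {x \<in> carrier G. x [^]\<^bsub>G\<^esub> p = \<one>\<^bsub>G\<^esub>} = p ^ g"
  shows "N \<subseteq> power_image (Fab_trunc p g c) p"
proof -
  let ?A = "Fab_trunc p g c"
  interpret A: comm_group ?A by (rule comm_group_Fab_trunc)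
  interpret G: comm_group G by (rule G)
  obtain h where h: "group_hom ?A G h" "h ` carrier ?A = carrier G" "kernel ?A G h = N"
    using epi_of_kernels_onto[OF comm_group_Fab_trunc G.is_group N] .
  interpret h: group_hom ?A G h by (rule h)
  have finG: "finite (carrier G)" using finite_imageI[OF finite_Fab_trunc, of h] h(2) by simp
  let ?S = "{x \<in> carrier ?A. h x \<in> power_image G p}"
  have im: "h ` power_image ?A p = power_image G p" by (rule hom_image_power_image[OF h(1,2)])
  have "card ?S = card (power_image G p) * card N"
    using h.card_preimage[OF finite_Fab_trunc, of "power_image G p"] h(2,3) G.power_image_subset by simp
  then have "card ?S * p ^ g = card (carrier G) * card N"
    using G.card_power_image_torsion[OF finG, of p] rank by simp
  also have "\<dots> = card (power_image ?A p) * p ^ g"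
    using card_mult_card_of_kernels_onto[OF G.is_group N] card_Fab_trunc
      A.card_power_image_torsion[OF finite_Fab_trunc, of p] torsion_Fab_trunc(2)[OF c] by simp
  finally have cards: "card (power_image ?A p) = card ?S" using prime_gt_0_nat[OF p] by simp
  have "power_image ?A p \<subseteq> ?S" unfolding im[symmetric] using A.power_image_subset by auto
  moreover have "finite ?S" using finite_Fab_trunc by simp
  ultimately have "power_image ?A p = ?S" using cards card_subset_eq by blast
  moreover have "N \<subseteq> ?S"
    unfolding h(3)[symmetric] kernel_def using subgroup.one_closed[OF G.subgroup_power_image] by auto
  ultimately show ?thesis by simp
qed

text \<open>Restrict the surjection with kernel \<open>N\<close> to the \<open>p\<close>-torsion of \<open>Fab_trunc p g c\<close>, which is
  \<open>p ^ (c - 1)\<close> times the group.\<close>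
lemma card_torsion_of_kernels_onto:
  assumes G: "comm_group G" and c: "c \<ge> 1" and N: "N \<in> kernels_onto (Fab_trunc p g c) G"
  shows "card (power_image G (p ^ (c - 1))) * card {x \<in> N. x [^]\<^bsub>Fab_trunc p g c\<^esub> p = \<one>\<^bsub>Fab_trunc p g c\<^esub>} = p ^ g"
proof -
  let ?A = "Fab_trunc p g c"
  let ?P = "power_image ?A (p ^ (c - 1))"
  interpret A: comm_group ?A by (rule comm_group_Fab_trunc)
  interpret G: comm_group G by (rule G)
  obtain h where h: "group_hom ?A G h" "h ` carrier ?A = carrier G" "kernel ?A G h = N"
    using epi_of_kernels_onto[OF comm_group_Fab_trunc G.is_group N] .
  interpret h: group_hom ?A G h by (rule h)
  have sP: "subgroup ?P ?A" by (rule A.subgroup_power_image)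
  have "x \<in> carrier ?A" if "x \<in> ?P" for x by (rule subsetD[OF A.power_image_subset that])
  then have "h \<in> hom (?A\<lparr>carrier := ?P\<rparr>) G" by (intro homI) simp_all
  then have hP: "group_hom (?A\<lparr>carrier := ?P\<rparr>) G h"
    using A.subgroup_imp_group[OF sP] by (simp add: group_hom_def group_hom_axioms_def)
  have finP: "finite ?P" using finite_subset[OF A.power_image_subset finite_Fab_trunc] .
  have "kernel (?A\<lparr>carrier := ?P\<rparr>) G h = ?P \<inter> N"
    unfolding h(3)[symmetric] kernel_def using A.power_image_subset by auto
  also have "\<dots> = {x \<in> N. x [^]\<^bsub>?A\<^esub> p = \<one>\<^bsub>?A\<^esub>}"
    unfolding torsion_Fab_trunc(1)[OF c, symmetric] h(3)[symmetric] kernel_def by auto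
  finally show ?thesis
    using group_hom.card_image_kernel[OF hP] finP hom_image_power_image[OF h(1,2)]
      torsion_Fab_trunc[OF c] by simp
qed

end

section \<open>The measure formula\<close>

text \<open>Here \<open>c\<close> is any truncation level that kills G, and \<open>r\<close> is the
  common rank of the kernels N. Leaving r free covers both halves of the theorem: r = u at the
  p-class itself and r = g above it.\<close>

lemma Meas_ab_eq:
  fixes G :: "('a, 'b) monoid_scheme"
  assumes p: "Factorial_Ring.prime p" and c: "c \<ge> 1"
    and G: "comm_group G" and fin: "finite (carrier G)"
    and exp: "\<And>x. x \<in> carrier G \<Longrightarrow> x [^]\<^bsub>G\<^esub> (p ^ c :: nat) = \<one>\<^bsub>G\<^esub>"
    and rank: "card {x \<in> carrier G. x [^]\<^bsub>G\<^esub> p = \<one>\<^bsub>G\<^esub>} = p ^ g"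
    and top: "card (power_image G (p ^ (c - 1))) = p ^ (g - r)" and r: "r \<le> g"
  shows "Meas_ab p g c G = 1 / (real (card_Aut G) * real (card (carrier G))) * real p ^ (g * (g + 1))
           * (\<Prod>k=1..g. 1 - 1 / real p ^ k) * (\<Prod>k=g+2-r..g+1. 1 - 1 / real p ^ k)"
proof -
  let ?A = "Fab_trunc p g c"
  interpret G: comm_group G by (rule G)
  interpret A: comm_group ?A by (rule comm_group_Fab_trunc)
  have p0: "p > 0" using p by (rule prime_gt_0_nat)
  have finA: "finite (carrier ?A)" by (rule finite_Fab_trunc[OF p])
  define n where "n = real (card (carrier G))"
  define a where "a = real (card_Aut G)"
  define K where "K = real (card (kernels_onto ?A G))"
  define F where "F = real (card (frattini ?A))"
  define R1 where "R1 = rank_factor p g g"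
  define R2 where "R2 = rank_factor p r (g + 1)"
  have n0: "n > 0" unfolding n_def using fin G.one_closed by (auto simp: card_gt_0_iff)
  have "card (generating_tuples G g) = card (kernels_onto ?A G) * card_Aut G"
    by (rule card_generating_tuples_eq_card_kernels[OF G fin finA]) (rule exp)
  then have "K * a = real (card (generating_tuples G g))" unfolding K_def a_def by simp
  also have "\<dots> = n ^ g * R1"
    unfolding n_def R1_def by (rule G.card_generating_tuples[OF fin p exp rank])
  finally have Ka: "K * a = n ^ g * R1" .
  \<comment> \<open>Generating g-tuples exist, so |Aut(G)| is nonzero and may be divided by.\<close>
  have "R1 \<noteq> 0" unfolding R1_def using rank_factor_pos_iff[OF prime_gt_1_nat[OF p]] by simp
  then have a0: "a \<noteq> 0" using Ka n0 by auto
  then have K: "K = n ^ g * R1 / a" using Ka by (simp add: field_simps)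
  have F: "F = real p ^ (g * (c - 1))"
    unfolding F_def frattini_Fab_trunc[OF p] using card_power_image_Fab_trunc[OF p, of g c 1] by simp
  then have F0: "F > 0" using p0 by simp
  have "g * c = g * (c - 1) + g" using c by (cases c) simp_all
  then have Ap: "real p ^ (g * c) = F * real p ^ g" using F by (simp add: power_add)
  have card_N: "real (card (generating_tuples (?A\<lparr>carrier := N\<rparr>) (g + 1))) = (F * real p ^ g / n) ^ (g + 1) * R2"
    if N: "N \<in> kernels_onto ?A G" for N
  proof -
    have sN: "subgroup N ?A" using N by (simp add: kernels_onto_def)
    \<comment> \<open>Cancelling |p^(c-1) G| = p^(g-r) from the torsion count leaves p^r, so N has
      rank r.\<close>
    have "p ^ (g - r) * card {x \<in> N. x [^]\<^bsub>?A\<^esub> p = \<one>\<^bsub>?A\<^esub>} = p ^ (g - r) * p ^ r"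
      using card_torsion_of_kernels_onto[OF p G c N] top r by (simp add: power_add[symmetric])
    then have t: "card {x \<in> N. x [^]\<^bsub>?A\<^esub> p = \<one>\<^bsub>?A\<^esub>} = p ^ r" using p0 by simp
    have "real (card (generating_tuples (?A\<lparr>carrier := N\<rparr>) (g + 1))) = real (card N) ^ (g + 1) * R2"
      unfolding R2_def
      by (rule card_generating_tuples_subgroup[OF comm_group_Fab_trunc sN finA p _ t, where k = c])
        (rule Fab_trunc_exponent)
    moreover have "n * real (card N) = F * real p ^ g"
      using arg_cong[OF card_mult_card_of_kernels_onto[OF p G.is_group N], of real] Ap
      unfolding n_def by simp
    then have "real (card N) = F * real p ^ g / n" using n0 by (simp add: field_simps)
    ultimately show ?thesis by simp
  qed
  have "N \<subseteq> frattini ?A" if "N \<in> kernels_onto ?A G" for N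
    unfolding frattini_Fab_trunc[OF p] by (rule kernels_onto_subset_power_image[OF p G c that rank])
  then have "card (presenting_tuples p g c G)
      = (\<Sum>N\<in>kernels_onto ?A G. card (generating_tuples (?A\<lparr>carrier := N\<rparr>) (g + 1)))"
    using finA by (rule card_presenting_tuples)
  then have "real (card (presenting_tuples p g c G)) = K * ((F * real p ^ g / n) ^ (g + 1) * R2)"
    using card_N unfolding K_def by simp
  then have "Meas_ab p g c G = K * ((F * real p ^ g / n) ^ (g + 1) * R2) / F ^ (g + 1)"
    unfolding Meas_ab_def F_def by simp
  also have "(F * real p ^ g / n) ^ (g + 1) = F ^ (g + 1) * real p ^ (g * (g + 1)) / n ^ (g + 1)"
    by (simp only: power_divide power_mult_distrib power_mult)
  \<comment> \<open>The number of kernels contributes n^g against n^(g+1) in the denominator, which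
    leaves the single factor 1/|G|; the powers of |\<Phi>(A)| cancel.\<close>
  also have "K * (F ^ (g + 1) * real p ^ (g * (g + 1)) / n ^ (g + 1) * R2) / F ^ (g + 1)
      = 1 / (a * n) * real p ^ (g * (g + 1)) * R1 * R2"
    unfolding K using F0 n0 a0 by (simp add: field_simps)
  also have "R1 = (\<Prod>k=1..g. 1 - 1 / real p ^ k)"
    unfolding R1_def using rank_factor_eq_prod[OF p0, of g g] by simp
  also have "R2 = (\<Prod>k=g+2-r..g+1. 1 - 1 / real p ^ k)"
    unfolding R2_def using rank_factor_eq_prod[OF p0, of r "g + 1"] r by simp
  finally show ?thesis unfolding a_def n_def .
qed

text \<open>Since e \<le> c and c \<ge> 1, the truncated difference e - (c-1) is 1 for e = c and 0
  otherwise, so the sum counts the cyclic factors of full order p^c.\<close>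

lemma sum_truncated_pred_eq:
  assumes "\<And>e. e \<in> set es \<Longrightarrow> e \<le> c" and "c \<ge> 1"
  shows "(\<Sum>i<length es. es ! i - (c - 1)) = length es - length (filter (\<lambda>e. e < c) es)"
proof -
  have "(\<Sum>e\<leftarrow>es. e - (c - 1)) + length (filter (\<lambda>e. e < c) es) = length es"
    using assms
  proof (induction es)
    case (Cons e es)
    have "e \<le> c" using Cons.prems(1) by simp
    moreover have "(\<Sum>e\<leftarrow>es. e - (c - 1)) + length (filter (\<lambda>e. e < c) es) = length es"
      using Cons by simp
    ultimately show ?case using \<open>c \<ge> 1\<close> by (cases "e < c") auto
  qed simp
  then show ?thesis by (simp add: sum_list_sum_nth lessThan_atLeast0)
qed

theorem theorem2p19:
  fixes G :: "('a, 'b) monoid_scheme" and p g c u :: nat and es :: "nat list"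
  assumes "Factorial_Ring.prime p" and "odd p" and "g \<ge> 1"
    and "comm_group G" and "finite (carrier G)" and "\<exists>k. card (carrier G) = p ^ k"
    and "has_p_class G p c" and "generator_rank G = g"
    and "G \<cong> product_group {..<length es} (\<lambda>i. integer_mod_group (p ^ (es ! i)))"
    and "\<forall>e\<in>set es. e \<ge> 1"
    and "u = length (filter (\<lambda>e. e < c) es)"
  shows "(Meas_ab p g c G =
           1 / (real (card_Aut G) * real (card (carrier G))) * real p ^ (g * (g + 1))
           * (\<Prod>k=1..g. 1 - 1 / real p ^ k) * (\<Prod>k=g+2-u..g+1. 1 - 1 / real p ^ k))
    \<and> (\<forall>c'>c. Meas_ab p g c' G =
           1 / (real (card_Aut G) * real (card (carrier G))) * real p ^ (g * (g + 1))
           * (\<Prod>k=1..g. 1 - 1 / real p ^ k) * (\<Prod>k=2..g+1. 1 - 1 / real p ^ k))"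
proof -
  interpret G: comm_group G by (rule assms(4))
  note p = assms(1) and fin = assms(5)
  have p0: "p > 0" and p1: "p > 1" using p by (rule prime_gt_0_nat, rule prime_gt_1_nat)
  have card_pow: "card (power_image G (p ^ k)) = p ^ (\<Sum>i<length es. es ! i - k)" for k
    by (rule card_power_image_product[OF p0 G.is_group assms(9)])
  have "power_image G (p ^ 0) = carrier G" using G.lower_p_central_eq[of p 0] by simp
  then have card_G: "card (carrier G) = p ^ (\<Sum>i<length es. es ! i)" using card_pow[of 0] by simp
  have triv: "power_image G (p ^ c) = {\<one>\<^bsub>G\<^esub>}"
    using assms(7) G.lower_p_central_eq[of p c] by (simp add: has_p_class_def)
  have exp: "x [^]\<^bsub>G\<^esub> (p ^ c) = \<one>\<^bsub>G\<^esub>" if "x \<in> carrier G" for x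
    using G.pow_in_power_image[OF that, of "p ^ c"] triv by simp
  \<comment> \<open>Passing to p-th powers lowers each exponent by exactly 1, as all are positive;
    hence the p-torsion has order p^(length es), and g is the number of cyclic factors.\<close>
  have "es ! i = es ! i - 1 + 1" if "i < length es" for i
    using bspec[OF assms(10) nth_mem[OF that]] by simp
  then have "(\<Sum>i<length es. es ! i) = (\<Sum>i<length es. (es ! i - 1) + 1)"
    by (intro sum.cong refl) (simp only: lessThan_iff)
  also have "\<dots> = (\<Sum>i<length es. es ! i - 1) + length es" by (simp only: sum.distrib) simp
  finally have rank: "card {x \<in> carrier G. x [^]\<^bsub>G\<^esub> p = \<one>\<^bsub>G\<^esub>} = p ^ length es"
    using G.card_power_image_torsion[OF fin, of p] card_G card_pow[of 1] p0 by (simp add: power_add)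
  then have g: "g = length es"
    using G.generator_rank_eq[OF fin p exp] assms(8) by simp
  \<comment> \<open>Triviality of p^c G makes every truncated difference vanish, so all exponents
    are at most c. As g \<ge> 1, some exponent exists, and c \<ge> 1 follows.\<close>
  have "p ^ (\<Sum>i<length es. es ! i - c) = 1" using card_pow[of c] triv by simp
  then have "(\<Sum>i<length es. es ! i - c) = 0" using p1 by simp
  then have "es ! i \<le> c" if "i < length es" for i using that by simp
  then have le_c: "e \<le> c" if "e \<in> set es" for e using that by (auto simp: in_set_conv_nth)
  have "es ! 0 \<in> set es" using assms(3) unfolding g by (intro nth_mem) linarith
  then have c1: "c \<ge> 1" using le_c[of "es ! 0"] assms(10) by fastforce
  have u: "u \<le> g" unfolding assms(11) g by (rule length_filter_le)
  have "(\<Sum>i<length es. es ! i - (c - 1)) = g - u"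
    unfolding g assms(11) by (rule sum_truncated_pred_eq[OF _ c1]) (rule le_c)
  then have "card (power_image G (p ^ (c - 1))) = p ^ (g - u)" unfolding card_pow by simp
  from Meas_ab_eq[OF p c1 assms(4) fin exp rank[folded g] this u]
  have first: "Meas_ab p g c G =
           1 / (real (card_Aut G) * real (card (carrier G))) * real p ^ (g * (g + 1))
           * (\<Prod>k=1..g. 1 - 1 / real p ^ k) * (\<Prod>k=g+2-u..g+1. 1 - 1 / real p ^ k)" .
  have "Meas_ab p g c' G =
           1 / (real (card_Aut G) * real (card (carrier G))) * real p ^ (g * (g + 1))
           * (\<Prod>k=1..g. 1 - 1 / real p ^ k) * (\<Prod>k=2..g+1. 1 - 1 / real p ^ k)" if c': "c' > c" for c'
  proof -
    have "p ^ c' = p ^ c * p ^ (c' - c)" using c' by (simp add: power_add[symmetric])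
    then have exp': "x [^]\<^bsub>G\<^esub> (p ^ c') = \<one>\<^bsub>G\<^esub>" if "x \<in> carrier G" for x
      using G.nat_pow_pow[OF that, of "p ^ c" "p ^ (c' - c)"] exp[OF that] by simp
    \<comment> \<open>For c' > c already p^(c'-1) G is trivial, so every kernel has full rank r = g
      and the second product starts at g + 2 - g = 2.\<close>
    have "es ! i - (c' - 1) = 0" if "i < length es" for i
      using le_c[OF nth_mem[OF that]] c' by simp
    then have "card (power_image G (p ^ (c' - 1))) = p ^ (g - g)" unfolding card_pow by simp
    from Meas_ab_eq[OF p _ assms(4) fin exp' rank[folded g] this order_refl] show ?thesis
      using c' by simp
  qed
  with first show ?thesis by blast
qed

end
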